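(* Let $N_n(x)=\sum_{k=1}^{n}\frac1n\binom{n}{k-1}\binom nk x^k$ be the Narayana polynomials, $n=1,2,\dots$. The asymptotic root-counting measure $\mu$ of the sequence $\{N_n(x)\}$ exists, is supported on $(-\infty,0]$, and its density $\rho$ and distribution function $\kappa(x)=\mu((-\infty,x])$ are given by $$\rho(x)=\frac1\pi\,\frac{1}{(1-x)\sqrt{-x}}\quad (x<0),\qquad \kappa(x)=1-\frac2\pi\arctan\sqrt{-x}\quad (x\le 0).$$
   Context: For a polynomial $P$ of degree $l$ with roots $x_1,\dots,x_l$ (listed with multiplicity), its root-counting measure is $\mu_P=\frac1l\sum_{i=1}^l\delta(x-x_i)$, where $\delta(x-x_i)$ is the Dirac measure at $x_i$. For a sequence of polynomials $P_n$ with $\deg P_n=n$, the asymptotic root-counting measure is the weak limit $\mu=\lim_{n\to\infty}\mu_{P_n}$ (in the sense of distributions), if it exists. *)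

theory Defs
  imports
    "HOL-Probability.Probability"
    "HOL-Computational_Algebra.Computational_Algebra"
begin

definition root_counting_measure :: "complex poly \<Rightarrow> complex measure" where
  "root_counting_measure p = measure_of UNIV (sets borel)
     (\<lambda>A. (\<Sum>x\<in>#proots p. emeasure (return borel x) A) / of_nat (degree p))"

(* The set function above is a measure, so measure_of does not fall back to the zero measure. *)
lemma emeasure_root_counting_measure:
  assumes "A \<in> sets borel"
  shows "emeasure (root_counting_measure p) A =
    (\<Sum>x\<in>#proots p. emeasure (return borel x) A) / of_nat (degree p)"
proof -
  have add: "countably_additive (sets borel)
      (\<lambda>A. \<Sum>x\<in>#M. emeasure (return borel x) A)" for M :: "complex multiset"
  proof (induction M)
    case empty
    show ?case by (simp add: countably_additive_def)
  next
    case (add x M)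
    show ?case unfolding countably_additive_def
    proof (intro allI impI)
      fix A :: "nat \<Rightarrow> complex set"
      assume A: "range A \<subseteq> sets borel" "disjoint_family A" "\<Union> (range A) \<in> sets borel"
      have "(\<Sum>i. emeasure (return borel x) (A i)) = emeasure (return borel x) (\<Union> (range A))"
        using A by (intro suminf_emeasure) auto
      moreover have "(\<Sum>i. \<Sum>x\<in>#M. emeasure (return borel x) (A i)) =
          (\<Sum>x\<in>#M. emeasure (return borel x) (\<Union> (range A)))"
        using add.IH A unfolding countably_additive_def by blast
      ultimately show "(\<Sum>i. \<Sum>x\<in>#add_mset x M. emeasure (return borel x) (A i)) =
          (\<Sum>x\<in>#add_mset x M. emeasure (return borel x) (\<Union> (range A)))"
        by (simp add: suminf_add[symmetric])
    qed
  qed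
  show ?thesis
  proof (rule emeasure_measure_of[OF root_counting_measure_def])
    show "positive (sets (root_counting_measure p))
        (\<lambda>A. (\<Sum>x\<in>#proots p. emeasure (return borel x) A) / of_nat (degree p))"
      by (auto simp: positive_def)
    have "sets (root_counting_measure p) = sets borel"
      unfolding root_counting_measure_def
      by (metis sets.sigma_sets_eq sets_measure_of space_borel subset_UNIV Pow_UNIV)
    thus "countably_additive (sets (root_counting_measure p))
        (\<lambda>A. (\<Sum>x\<in>#proots p. emeasure (return borel x) A) / of_nat (degree p))"
      using add[of "proots p"]
      by (auto simp: countably_additive_def divide_ennreal_def ennreal_suminf_multc)
    show "A \<in> sets (root_counting_measure p)"
      using assms \<open>sets (root_counting_measure p) = sets borel\<close> by simp
  qed auto
qed

(* Infinitely differentiable: every iterated directional derivative, in any list of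
   directions, exists and is again differentiable everywhere. On the complex plane, seen as a
   real normed space, this is real smoothness (frechet_derivative is real-linear). *)
definition smooth :: "('a::real_normed_vector \<Rightarrow> real) \<Rightarrow> bool" where
  "smooth f \<longleftrightarrow>
     (\<forall>vs. foldr (\<lambda>v g z. frechet_derivative g (at z) v) vs f differentiable_on UNIV)"

definition test_function :: "('a::real_normed_vector \<Rightarrow> real) \<Rightarrow> bool" where
  "test_function \<phi> \<longleftrightarrow> smooth \<phi> \<and> compact (closure {z. \<phi> z \<noteq> 0})"

(* Locally finite Borel measures. Finiteness on compact sets makes test functions integrable;
   otherwise the Bochner integral would be 0 by convention. *)
definition radon_measure :: "'a::topological_space measure \<Rightarrow> bool" where
  "radon_measure \<mu> \<longleftrightarrow> sets \<mu> = sets borel \<and> (\<forall>K. compact K \<longrightarrow> emeasure \<mu> K < \<infinity>)"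

definition distributional_limit ::
    "(nat \<Rightarrow> 'a::real_normed_vector measure) \<Rightarrow> 'a measure \<Rightarrow> bool" where
  "distributional_limit M \<mu> \<longleftrightarrow>
     (\<forall>\<phi>. test_function \<phi> \<longrightarrow> (\<lambda>n. \<integral>z. \<phi> z \<partial>M n) \<longlonglongrightarrow> (\<integral>z. \<phi> z \<partial>\<mu>))"

definition asymptotic_root_counting_measure ::
    "(nat \<Rightarrow> complex poly) \<Rightarrow> complex measure \<Rightarrow> bool" where
  "asymptotic_root_counting_measure P \<mu> \<longleftrightarrow>
     radon_measure \<mu> \<and> distributional_limit (\<lambda>n. root_counting_measure (P n)) \<mu>"

(* Meant for n \<ge> 1; the term n = 0 is the zero polynomial and does not affect limits. *)
definition narayana_poly :: "nat \<Rightarrow> complex poly" where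
  "narayana_poly n =
     (\<Sum>k=1..n. monom (1 / of_nat n * of_nat (n choose (k - 1)) * of_nat (n choose k)) k)"

lemma degree_narayana_poly: "degree (narayana_poly n) = n"
proof (cases "n = 0")
  case False
  have "n choose (n - 1) = n"
    using False binomial_symmetric[of "n - 1" n] by simp
  hence "coeff (narayana_poly n) n = 1"
    using False by (simp add: narayana_poly_def coeff_sum)
  moreover have "degree (narayana_poly n) \<le> n"
    unfolding narayana_poly_def
    by (intro degree_sum_le) (auto intro: order.trans[OF degree_monom_le])
  ultimately show ?thesis
    by (metis le_antisym le_degree zero_neq_one)
qed (simp add: narayana_poly_def)

end

theory Submission
  imports Defs
begin

text \<open>
  Substitute \<open>u = 1 / (1 - x)\<close>, which maps the half-line \<open>x \<le> 0\<close> into the compact interval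
  \<open>[0, 1]\<close> and infinity to \<open>0\<close>.  Up to elementary factors, the \<open>n\<close>-th Narayana polynomial
  becomes a Jacobi polynomial in \<open>u\<close>, and the zeros of Jacobi polynomials follow the arcsine law.
  Pulled back to \<open>x\<close>, the arcsine law has the density and distribution function of the theorem.

  The asymptotics of the zeros need no orthogonality.  The coefficients of \<open>N\<^sub>n\<close> satisfy a two-term
  recurrence, hence \<open>N\<^sub>n\<close> solves a linear differential equation of order two
  (\<open>narayana_poly_ode\<close>), from which everything about the points \<open>u\<close> is read off:

  \<^item> At a zero, the equation says that the points \<open>u\<close>, together with a charge at \<open>0\<close>, are in
    electrostatic equilibrium: the sum of \<open>1 / (v - w)\<close> over the other points \<open>v\<close> is \<open>1 / w\<close>, unless
    \<open>w = 1\<close> (\<open>node_equilibrium\<close>).  An extreme point of the configuration cannot be in equilibrium, so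
    all points are in the convex hull of \<open>0\<close> and \<open>1\<close> (\<open>node_in_unit_interval\<close>).

  \<^item> Rewritten for the logarithmic derivative as a formal power series, the equation is a
    recurrence for the power sums of the points (\<open>power_sum_recurrence\<close>).  Divided by \<open>n\<^sup>2\<close>, it
    converges to the statement that the generating function \<open>f\<close> of the limiting moments satisfies
    \<open>f(s)\<^sup>2 (1 - s) = 1\<close>.  So the moments converge to those of the arcsine law
    (\<open>power_sum_tendsto\<close>, \<open>limit_moments\<close>).

  On a compact interval, convergence of all moments implies weak convergence
  (\<open>method_of_moments\<close>).  A test function in \<open>x\<close> vanishes near infinity, so it is a
  continuous function of \<open>u\<close> on all of \<open>[0, 1]\<close> and no mass is lost
  (\<open>test_function_pullback\<close>).

  The limit is unique because test functions approximate indicators of boxes, so that they determine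
  a locally finite measure (\<open>radon_measure_eqI\<close>).
\<close>

section \<open>The differential equation of the Narayana polynomials\<close>

lemma coeff_narayana_poly:
  "coeff (narayana_poly n) k =
     (if k = 0 then 0 else of_nat (n choose (k - 1)) * of_nat (n choose k) / of_nat n)"
proof (cases "k \<in> {1..n}")
  case True
  then show ?thesis
    by (auto simp: narayana_poly_def coeff_sum)
next
  case False
  then show ?thesis
    by (auto simp: narayana_poly_def coeff_sum binomial_eq_0 not_le Suc_le_eq)
qed

lemma Suc_times_binomial_Suc_field:
  "of_nat (Suc k) * of_nat (n choose Suc k) = (of_nat n - of_nat k) * (of_nat (n choose k) :: 'a::field_char_0)"
proof (cases "k \<le> n")
  case True
  have "Suc k * (n choose Suc k) = (n - k) * (n choose k)"
    using binomial_absorb_comp[of n k] binomial_absorption[of k n] by (metis mult.commute)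
  then have "of_nat (Suc k * (n choose Suc k)) = (of_nat ((n - k) * (n choose k)) :: 'a)"
    by (rule arg_cong)
  with True show ?thesis by (simp only: of_nat_mult of_nat_diff)
qed (simp add: binomial_eq_0)

lemma coeff_narayana_poly_Suc:
  "of_nat k * of_nat (Suc k) * coeff (narayana_poly n) (Suc k) =
    (of_nat n - of_nat k) * (of_nat n + 1 - of_nat k) * coeff (narayana_poly n) k"
proof (cases k)
  case 0
  then show ?thesis by (simp add: coeff_narayana_poly)
next
  case k: (Suc j)
  have 1: "of_nat k * of_nat (n choose k) = (of_nat n - of_nat j) * (of_nat (n choose j) :: complex)"
    unfolding k by (rule Suc_times_binomial_Suc_field)
  have 2: "of_nat (Suc k) * of_nat (n choose Suc k) = (of_nat n - of_nat k) * (of_nat (n choose k) :: complex)"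
    by (rule Suc_times_binomial_Suc_field)
  have "of_nat k * of_nat (Suc k) * coeff (narayana_poly n) (Suc k) =
     (of_nat k * of_nat (n choose k)) * (of_nat (Suc k) * of_nat (n choose Suc k)) / of_nat n"
    by (simp add: coeff_narayana_poly)
  also have "\<dots> = (of_nat n - of_nat j) * (of_nat n - of_nat k) * (of_nat (n choose j) * of_nat (n choose k) / of_nat n)"
    unfolding 1 2 by simp
  also have "\<dots> = (of_nat n - of_nat k) * (of_nat n + 1 - of_nat k) * coeff (narayana_poly n) k"
    by (simp add: coeff_narayana_poly k)
  finally show ?thesis .
qed

text \<open>
  The coefficients of \<open>x\<^sup>k\<close> agree by \<open>coeff_narayana_poly_Suc\<close>, because
  \<open>k (k - 1) - 2 n k + n (n + 1) = (n - k) (n + 1 - k)\<close>.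
\<close>
lemma narayana_poly_ode:
  "[:0, 1:] * ([:1, -1:] * pderiv (pderiv (narayana_poly n)) + smult (2 * of_nat n) (pderiv (narayana_poly n))) =
   smult (of_nat n * (of_nat n + 1)) (narayana_poly n)" (is "?L = ?R")
proof (rule poly_eqI)
  fix k
  show "coeff ?L k = coeff ?R k"
  proof (cases k)
    case 0
    then show ?thesis by (simp add: coeff_narayana_poly)
  next
    case (Suc j)
    have "coeff ?L k = of_nat k * of_nat (Suc k) * coeff (narayana_poly n) (Suc k) -
        of_nat j * of_nat k * coeff (narayana_poly n) k + 2 * of_nat n * of_nat k * coeff (narayana_poly n) k"
      by (cases j) (simp_all add: Suc coeff_pderiv algebra_simps)
    also have "of_nat k * of_nat (Suc k) * coeff (narayana_poly n) (Suc k) =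
        (of_nat n - of_nat k) * (of_nat n + 1 - of_nat k) * coeff (narayana_poly n) k"
      by (rule coeff_narayana_poly_Suc)
    finally show ?thesis by (simp add: Suc algebra_simps)
  qed
qed

definition narayana_nodes :: "nat \<Rightarrow> complex multiset" where
  "narayana_nodes n = image_mset (\<lambda>x. 1 / (1 - x)) (proots (narayana_poly n))"

lemma size_narayana_nodes [simp]: "size (narayana_nodes n) = n"
  by (simp add: narayana_nodes_def size_proots_complex degree_narayana_poly)

text \<open>
  The roots are the reciprocals of the nonzero elements of \<open>U\<close>, and the constant coefficient is
  \<open>1\<close>, so that the polynomial is a unit among the formal power series.
\<close>
definition recip_poly :: "complex multiset \<Rightarrow> complex poly" where
  "recip_poly U = (\<Prod>u\<in>#U. [:1, -u:])"

lemma recip_poly_empty [simp]: "recip_poly {#} = 1"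
  and recip_poly_add [simp]: "recip_poly (add_mset u U) = [:1, -u:] * recip_poly U"
  by (simp_all add: recip_poly_def)

lemma recip_poly_nz [simp]: "recip_poly U \<noteq> 0"
  by (induction U) (simp_all del: mult_pCons_left)

text \<open>
  This is the equation of \<open>narayana_poly_ode\<close> after the substitution \<open>s = 1 - x\<close>, stated for
  the polynomial with roots \<open>s = 1 / u\<close>.  All further information about the nodes is derived from it.
\<close>
definition node_ode :: "complex multiset \<Rightarrow> bool" where
  "node_ode U \<longleftrightarrow>
    [:1, -1:] * ([:0, 1:] * pderiv (pderiv (recip_poly U)) - smult (2 * of_nat (size U)) (pderiv (recip_poly U))) =
    smult (of_nat (size U) * (of_nat (size U) + 1)) (recip_poly U)"

text \<open>
  A root \<open>x = 1\<close> would have no node; the coefficients are positive, so there is none.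
\<close>
lemma poly_narayana_poly_1:
  assumes "n > 0"
  shows "poly (narayana_poly n) 1 \<noteq> 0"
proof -
  have "poly (narayana_poly n) 1 =
      of_real (\<Sum>k=1..n. 1 / of_nat n * of_nat (n choose (k - 1)) * of_nat (n choose k))"
    by (simp add: narayana_poly_def poly_sum poly_monom)
  moreover have "(\<Sum>k=1..n. 1 / real n * of_nat (n choose (k - 1)) * of_nat (n choose k)) > 0"
    using assms by (intro sum_pos) auto
  ultimately show ?thesis by (metis less_irrefl of_real_eq_0_iff)
qed

lemma proots_narayana_poly_neq_1:
  assumes "x \<in># proots (narayana_poly n)"
  shows "x \<noteq> 1"
proof (cases "n = 0")
  case False
  then show ?thesis using assms poly_narayana_poly_1[of n] 
    by (cases "narayana_poly n = 0") auto
qed (use assms in \<open>simp add: narayana_poly_def\<close>)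

lemma pcompose_prod_mset:
  "pcompose (\<Prod>x\<in>#X. f x) q = (\<Prod>x\<in>#X. pcompose (f x) q)" for q :: "'a::comm_ring_1 poly"
  by (induction X) (simp_all add: pcompose_mult pcompose_1)

text \<open>
  \<open>N\<^sub>n(1 - s)\<close> is the product of \<open>1 - x - s = (1 - x) (1 - u s)\<close> over the roots \<open>x\<close> with nodes \<open>u = 1 / (1 - x)\<close>.
\<close>
lemma narayana_poly_via_nodes:
  assumes "n > 0"
  obtains c where "c \<noteq> 0" "pcompose (narayana_poly n) [:1, -1:] = smult c (recip_poly (narayana_nodes n))"
proof -
  define X where "X = proots (narayana_poly n)"
  have one: "1 \<notin># X" using proots_narayana_poly_neq_1 X_def by auto
  have "coeff (narayana_poly n) n = 1"
    using assms binomial_symmetric[of "n - 1" n] by (simp add: coeff_narayana_poly)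
  then have "narayana_poly n = (\<Prod>x\<in>#X. [:-x, 1:])"
    using complex_poly_decompose_multiset[of "narayana_poly n"]
    by (simp add: X_def degree_narayana_poly)
  then have eq: "pcompose (narayana_poly n) [:1, -1:] = (\<Prod>x\<in>#X. [:1 - x, -1:])"
    by (simp add: pcompose_prod_mset pcompose_pCons)
  have "\<exists>c. c \<noteq> 0 \<and> (\<Prod>x\<in>#X. [:1 - x, -1:]) = smult c (recip_poly (image_mset (\<lambda>x. 1 / (1 - x)) X))"
    using one
  proof (induction X)
    case (add x X)
    then obtain c where c: "c \<noteq> 0" "(\<Prod>x\<in>#X. [:1 - x, -1:]) = smult c (recip_poly (image_mset (\<lambda>x. 1 / (1 - x)) X))"
      by auto
    have "[:1 - x, -1:] = smult (1 - x) [:1, - (1 / (1 - x)):]"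
      using add.prems by auto
    then have "(\<Prod>x\<in>#add_mset x X. [:1 - x, -1:]) =
        smult ((1 - x) * c) (recip_poly (image_mset (\<lambda>x. 1 / (1 - x)) (add_mset x X)))"
      by (simp only: c image_mset_add_mset prod_mset.add_mset recip_poly_add mult_smult_left mult_smult_right smult_smult mult.commute)
    then show ?case using c(1) add.prems by (intro exI[of _ "(1-x) * c"]) auto
  qed (auto intro: exI[of _ 1])
  then show thesis using that eq unfolding narayana_nodes_def X_def by metis
qed

lemma node_ode_narayana_nodes:
  assumes "n > 0"
  shows "node_ode (narayana_nodes n)"
proof -
  define N where "N = narayana_poly n"
  define q :: "complex poly" where "q = [:1, -1:]"
  define a b :: complex where "a = 2 * of_nat n" and "b = of_nat n * (of_nat n + 1)"
  obtain c where c: "c \<noteq> 0" "pcompose N q = smult c (recip_poly (narayana_nodes n))"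
    using narayana_poly_via_nodes[OF assms] unfolding N_def q_def by metis
  define R where "R = pcompose N q"
  define B where "B = recip_poly (narayana_nodes n)"
  have dR: "pderiv R = - pcompose (pderiv N) q"
    by (simp add: R_def pderiv_pcompose q_def pderiv_pCons)
  have ddR: "pderiv (pderiv R) = pcompose (pderiv (pderiv N)) q"
    by (simp add: dR pderiv_minus pderiv_pcompose q_def pderiv_pCons)
  have q: "pcompose [:0, 1:] q = q" "pcompose [:1, -1:] q = [:0, 1:]"
    by (simp_all add: q_def pcompose_pCons)
  have "pcompose ([:0, 1:] * ([:1, -1:] * pderiv (pderiv N) + smult a (pderiv N))) q = pcompose (smult b N) q"
    unfolding N_def a_def b_def narayana_poly_ode ..
  then have "q * ([:0, 1:] * pcompose (pderiv (pderiv N)) q + smult a (pcompose (pderiv N) q)) = smult b R"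
    unfolding pcompose_mult pcompose_add pcompose_smult q R_def .
  then have "q * ([:0, 1:] * pderiv (pderiv R) - smult a (pderiv R)) = smult b R"
    unfolding ddR unfolding dR smult_minus_right diff_minus_eq_add .
  moreover have "R = smult c B" using c by (simp add: R_def B_def)
  ultimately have "smult c (q * ([:0, 1:] * pderiv (pderiv B) - smult a (pderiv B))) = smult c (smult b B)"
    by (simp add: pderiv_smult algebra_simps smult_diff_right del: mult_pCons_left)
  then have "q * ([:0, 1:] * pderiv (pderiv B) - smult a (pderiv B)) = smult b B"
    using c(1) smult_cancel by blast
  then show ?thesis unfolding node_ode_def B_def q_def a_def b_def by simp
qed

section \<open>Limits of the power sums of the nodes\<close>

definition power_sum :: "'a::comm_semiring_1 multiset \<Rightarrow> nat \<Rightarrow> 'a" where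
  "power_sum U k = (\<Sum>u\<in>#U. u ^ k)"

text \<open>
  Newton's identities in logarithmic form: each factor \<open>1 - u s\<close> contributes the geometric series
  of \<open>u / (1 - u s)\<close> to the negative of the logarithmic derivative.
\<close>
lemma fps_deriv_recip_poly:
  "fps_deriv (fps_of_poly (recip_poly U)) =
     - fps_of_poly (recip_poly U) * Abs_fps (\<lambda>k. power_sum U (Suc k))"
proof (induction U)
  case empty
  have "Abs_fps (\<lambda>k. power_sum {#} (Suc k)) = (0 :: complex fps)"
    by (rule fps_ext) (simp add: power_sum_def)
  then show ?case by simp
next
  case (add u U)
  define B where "B = fps_of_poly (recip_poly U)"
  define l where "l = (1 - fps_const u * fps_X :: complex fps)"
  have l: "fps_of_poly [:1, -u:] = l"
    by (simp add: l_def fps_of_poly_pCons fps_const_neg[symmetric] del: fps_const_neg)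
  have dl: "fps_deriv l = - fps_const u"
    by (simp add: l_def)
  \<comment> \<open>The geometric series of \<open>u / (1 - u s)\<close>.\<close>
  have geo: "l * Abs_fps (\<lambda>k. u ^ Suc k) = fps_const u"
  proof (rule fps_ext)
    fix k show "fps_nth (l * Abs_fps (\<lambda>k. u ^ Suc k)) k = fps_nth (fps_const u) k"
      by (cases k) (simp_all add: l_def left_diff_distrib mult.assoc)
  qed
  have sum: "Abs_fps (\<lambda>k. power_sum (add_mset u U) (Suc k)) =
      Abs_fps (\<lambda>k. u ^ Suc k) + Abs_fps (\<lambda>k. power_sum U (Suc k))"
    by (rule fps_ext) (simp add: power_sum_def)
  have "fps_deriv (fps_of_poly (recip_poly (add_mset u U))) = fps_deriv (l * B)"
    by (simp only: recip_poly_add fps_of_poly_mult l B_def)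
  also have "\<dots> = l * (- B * Abs_fps (\<lambda>k. power_sum U (Suc k))) + (- fps_const u) * B"
    unfolding fps_deriv_mult dl using add.IH by (simp add: B_def)
  also have "\<dots> = - (l * B) * Abs_fps (\<lambda>k. power_sum (add_mset u U) (Suc k))"
    unfolding sum geo[symmetric] by (simp add: algebra_simps)
  also have "l * B = fps_of_poly (recip_poly (add_mset u U))"
    by (simp only: recip_poly_add fps_of_poly_mult l B_def)
  finally show ?case .
qed

text \<open>
  With \<open>Q\<close> the power series of the power sums from the first on, \<open>B' = - B Q\<close> and \<open>B'' = B (Q\<^sup>2 - Q')\<close>.  The
  linear equation for \<open>B\<close> thus becomes, after cancelling \<open>B\<close>, the Riccati equation
  \<open>(1 - s) (s (Q\<^sup>2 - Q') + 2 n Q) = n (n + 1)\<close>.  Its coefficients at \<open>s\<^sup>k\<close> are the claim, because dividing by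
  \<open>1 - s\<close> makes the right-hand side a constant sequence.
\<close>
lemma power_sum_recurrence:
  assumes "node_ode U"
  shows "(2 * of_nat (size U) - of_nat k) * power_sum U (Suc k) +
    (\<Sum>a<k. power_sum U (Suc a) * power_sum U (k - a)) = of_nat (size U) * (of_nat (size U) + 1)"
proof -
  define n where "n = size U"
  define B where "B = fps_of_poly (recip_poly U)"
  define Q where "Q = Abs_fps (\<lambda>k. power_sum U (Suc k))"
  define C where "C = fps_const (of_nat n * (of_nat n + 1) :: complex)"
  define D where "D = fps_const (2 * of_nat n :: complex)"
  have B0: "B \<noteq> 0" by (simp add: B_def)
  have dB: "fps_deriv B = - B * Q" unfolding B_def Q_def by (rule fps_deriv_recip_poly)
  then have ddB: "fps_deriv (fps_deriv B) = B * (Q * Q - fps_deriv Q)"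
    by (simp add: algebra_simps)
  have "fps_of_poly ([:1, -1:] * ([:0, 1:] * pderiv (pderiv (recip_poly U)) - smult (2 * of_nat n) (pderiv (recip_poly U)))) =
    fps_of_poly (smult (of_nat n * (of_nat n + 1)) (recip_poly U))"
    using assms unfolding node_ode_def n_def by (rule arg_cong)
  moreover have "fps_of_poly [:1, -1:] = (1 - fps_X :: complex fps)" "fps_of_poly [:0, 1:] = (fps_X :: complex fps)"
    by (simp_all add: fps_of_poly_pCons fps_const_neg[symmetric] del: fps_const_neg)
  ultimately have "(1 - fps_X) * (fps_X * fps_deriv (fps_deriv B) - D * fps_deriv B) = C * B"
    unfolding fps_of_poly_mult fps_of_poly_diff fps_of_poly_smult fps_of_poly_pderiv
    by (simp add: B_def C_def D_def)
  then have "B * ((1 - fps_X) * (fps_X * (Q * Q - fps_deriv Q) + D * Q)) = B * C"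
    unfolding ddB unfolding dB by (simp add: algebra_simps)
  then have eq: "(1 - fps_X) * (fps_X * (Q * Q - fps_deriv Q) + D * Q) = C"
    using B0 by simp
  define E where "E = fps_X * (Q * Q - fps_deriv Q) + D * Q"
  have E0: "fps_nth E 0 = of_nat n * (of_nat n + 1)"
    using arg_cong[OF eq, of "\<lambda>f. fps_nth f 0"] by (simp add: E_def C_def)
  \<comment> \<open>Multiplying by \<open>1 - s\<close> takes differences of consecutive coefficients.\<close>
  have ES: "fps_nth E (Suc k) = fps_nth E k" for k
    using arg_cong[OF eq, of "\<lambda>f. fps_nth f (Suc k)"] unfolding E_def[symmetric] by (simp add: C_def algebra_simps)
  have E: "fps_nth E k = of_nat n * (of_nat n + 1)" for k
    by (induction k) (simp_all add: E0 ES)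
  show ?thesis
  proof (cases k)
    case 0
    then show ?thesis using E[of 0] by (simp add: E_def D_def Q_def n_def)
  next
    case (Suc j)
    have "(\<Sum>a<k. power_sum U (Suc a) * power_sum U (k - a)) = fps_nth (Q * Q) j"
      unfolding fps_mult_nth Suc by (intro sum.cong) (auto simp: Q_def Suc_diff_le)
    then show ?thesis using E[of k]
      by (simp add: E_def D_def Suc n_def algebra_simps) (simp add: Q_def algebra_simps)
  qed
qed

text \<open>
  The coefficients of \<open>(1 - s)\<close> to the power \<open>-1/2\<close>, which is the generating function of the
  moments of the arcsine law on the unit interval.
\<close>
definition arcsine_moment :: "nat \<Rightarrow> real" where
  "arcsine_moment k = (-1) ^ k * ((-1/2) gchoose k)"

lemma arcsine_moment_0 [simp]: "arcsine_moment 0 = 1"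
  by (simp add: arcsine_moment_def)

lemma arcsine_moment_Suc:
  "(real k + 1) * arcsine_moment (Suc k) = (real k + 1 / 2) * arcsine_moment k"
proof -
  \<comment> \<open>A variable keeps the simplifier from evaluating the binomial coefficients at the numeral.\<close>
  define a :: real where "a = -1/2"
  have "(real k + 1) * (a gchoose Suc k) = - ((real k - a) * (a gchoose k))"
    using gbinomial_mult_1[of a k] unfolding of_nat_Suc ring_distribs by linarith
  then have "(-1) ^ Suc k * ((real k + 1) * (a gchoose Suc k)) = (-1) ^ k * ((real k - a) * (a gchoose k))"
    by (simp only: power_Suc mult_minus_left mult_minus_right minus_minus mult_1_left)
  then show ?thesis
    unfolding arcsine_moment_def a_def by (simp only: mult.left_commute) simp
qed

text \<open>
  The square of \<open>(1 - s)\<close> to the power \<open>-1/2\<close> is the geometric series.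
\<close>
lemma arcsine_moment_convolution:
  "(\<Sum>a\<le>k. arcsine_moment a * arcsine_moment (k - a)) = 1"
proof -
  have "(\<Sum>a\<le>k. arcsine_moment a * arcsine_moment (k - a)) =
      (-1) ^ k * (\<Sum>a=0..k. ((-1/2) gchoose a) * ((-1/2) gchoose (k - a)))"
    unfolding sum_distrib_left arcsine_moment_def atMost_atLeast0
    by (intro sum.cong) (auto simp: power_add[symmetric] algebra_simps)
  also have "\<dots> = (-1) ^ k * ((-1) gchoose k)"
    by (subst gbinomial_Vandermonde) simp
  also have "\<dots> = 1"
    by (simp add: gbinomial_minus[of 1 k, simplified] binomial_gbinomial[symmetric] power_mult_distrib[symmetric])
  finally show ?thesis .
qed

text \<open>
  Solved for the \<open>k\<close>-th moment, \<open>power_sum_recurrence\<close> expresses it by the lower moments.  In the limit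
  this is the recurrence that \<open>arcsine_moment_convolution\<close> gives for the arcsine moments.
\<close>
lemma power_sum_tendsto:
  assumes sz: "\<And>n. size (U n) = n" and ode: "\<And>n. n > 0 \<Longrightarrow> node_ode (U n)"
  shows "(\<lambda>n. power_sum (U n) k / of_nat n) \<longlonglongrightarrow> complex_of_real (arcsine_moment k)"
proof (induction k rule: less_induct)
  case (less k)
  define m where "m n k = power_sum (U n) k / of_nat n" for n k
  have IH: "(\<lambda>n. m n j) \<longlonglongrightarrow> of_real (arcsine_moment j)" if "j < k" for j
    using less that by (simp add: m_def)
  have inv: "(\<lambda>n. c / of_nat n) \<longlonglongrightarrow> 0" for c :: complex
    by (rule lim_const_over_n)
  show ?case
  proof (cases k)
    case 0
    have "eventually (\<lambda>n. power_sum (U n) k / of_nat n = 1) sequentially"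
      using eventually_gt_at_top[of 0] by eventually_elim (simp add: 0 power_sum_def sz)
    then show ?thesis by (simp add: 0 tendsto_eventually)
  next
    case (Suc j)
    have ev: "eventually (\<lambda>n. ((1 + 1 / of_nat n) - (\<Sum>a<j. m n (Suc a) * m n (j - a))) / (2 - of_nat j / of_nat n) = m n k) sequentially"
      using eventually_gt_at_top[of "j + 1"]
    proof eventually_elim
      case (elim n)
      then have n: "(of_nat n :: complex) \<noteq> 0" "(2 * of_nat n - of_nat j :: complex) \<noteq> 0"
      proof -
        have "(2 * of_nat n - of_nat j :: complex) = of_nat (2 * n - j)"
          using elim by (simp add: of_nat_diff)
        with elim show "(of_nat n :: complex) \<noteq> 0" "(2 * of_nat n - of_nat j :: complex) \<noteq> 0"
          by (auto simp only: of_nat_eq_0_iff)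
      qed
      have "(2 * of_nat n - of_nat j) * power_sum (U n) k + (\<Sum>a<j. power_sum (U n) (Suc a) * power_sum (U n) (j - a)) = of_nat n * (of_nat n + 1)"
        using power_sum_recurrence[OF ode, of n j] elim unfolding sz Suc by simp
      moreover have "(\<Sum>a<j. power_sum (U n) (Suc a) * power_sum (U n) (j - a)) =
        of_nat n * of_nat n * (\<Sum>a<j. m n (Suc a) * m n (j - a))"
        using n unfolding sum_distrib_left by (intro sum.cong) (auto simp: m_def)
      moreover have "power_sum (U n) k = of_nat n * m n k" using n by (simp add: m_def)
      ultimately have "(of_nat n * of_nat n) * ((2 - of_nat j / of_nat n) * m n k + (\<Sum>a<j. m n (Suc a) * m n (j - a)))
         = (of_nat n * of_nat n) * (1 + 1 / of_nat n)"
        using n by (simp add: field_simps)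
      then have "(2 - of_nat j / of_nat n) * m n k + (\<Sum>a<j. m n (Suc a) * m n (j - a)) = 1 + 1 / of_nat n"
        using n by simp
      moreover have "2 - of_nat j / of_nat n \<noteq> (0::complex)" using n by (simp add: field_simps)
      ultimately show ?case by (simp add: field_simps)
    qed
    have lim: "(\<lambda>n. ((1 + 1 / of_nat n) - (\<Sum>a<j. m n (Suc a) * m n (j - a))) / (2 - of_nat j / of_nat n)) \<longlonglongrightarrow>
        ((1 + 0) - (\<Sum>a<j. of_real (arcsine_moment (Suc a)) * of_real (arcsine_moment (j - a)))) / (2 - 0)"
      by (intro tendsto_intros inv IH) (auto simp: Suc)
    have val: "((1 + 0) - (\<Sum>a<j. of_real (arcsine_moment (Suc a)) * of_real (arcsine_moment (j - a)))) / (2 - 0) =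
        complex_of_real (arcsine_moment k)"
    proof -
      have "1 = (\<Sum>a\<le>k. arcsine_moment a * arcsine_moment (k - a))"
        by (simp add: arcsine_moment_convolution)
      also have "\<dots> = 2 * arcsine_moment k + (\<Sum>a<j. arcsine_moment (Suc a) * arcsine_moment (j - a))"
        unfolding Suc sum.atMost_Suc_shift by (simp add: lessThan_Suc_atMost[symmetric])
      finally have "arcsine_moment k = (1 - (\<Sum>a<j. arcsine_moment (Suc a) * arcsine_moment (j - a))) / 2"
        by simp
      then have "complex_of_real (arcsine_moment k) =
          of_real ((1 - (\<Sum>a<j. arcsine_moment (Suc a) * arcsine_moment (j - a))) / 2)"
        by (rule arg_cong)
      then show ?thesis by (simp only: of_real_divide of_real_diff of_real_sum of_real_mult) simp
    qed
    show ?thesis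
      using Lim_transform_eventually[OF lim ev] unfolding val by (simp only: m_def)
  qed
qed

section \<open>The nodes lie in the unit interval\<close>

text \<open>
  If \<open>1 / w\<close> were a root of \<open>recip_poly\<close> of order \<open>k + 2\<close>, then all terms of the equation except the one with the
  second derivative would be divisible by the power \<open>k + 1\<close> of the linear factor, whereas that term has order
  exactly \<open>k\<close>, since its factors \<open>s\<close> and \<open>1 - s\<close> do not vanish at \<open>1 / w\<close>.
\<close>
lemma node_ode_simple:
  assumes ode: "node_ode (add_mset w V)" and w: "w \<noteq> 0" "w \<noteq> 1"
  shows "poly (recip_poly V) (1 / w) \<noteq> 0"
proof
  define B where "B = recip_poly (add_mset w V)"
  define s where "s = 1 / w"
  define n where "n = size (add_mset w V)"
  define d where "d = [:-s, 1:]"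
  assume "poly (recip_poly V) (1 / w) = 0"
  then have root: "poly B s = 0" "poly (pderiv B) s = 0"
    using w by (simp_all add: B_def s_def pderiv_mult pderiv_pCons del: mult_pCons_left)
  have s: "s \<noteq> 0" "s \<noteq> 1" using w by (auto simp: s_def)
  have B: "B \<noteq> 0" by (simp add: B_def del: recip_poly_add)
  have nz: "p \<noteq> 0 \<Longrightarrow> poly p s = 0 \<Longrightarrow> pderiv p \<noteq> 0" for p
    by (metis pderiv_eq_0_iff degree_eq_zeroE mult_zero_right add_0_right poly_pCons poly_0 pCons_0_0)
  note dB = nz[OF B root(1)]
  note ddB = nz[OF dB root(2)]
  define k where "k = order s (pderiv (pderiv B))"
  have ord: "order s (pderiv B) = Suc k" "order s B = Suc (Suc k)"
    using B dB ddB root by (metis k_def order_pderiv order_root)+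
  have "[:1, -1:] * ([:0, 1:] * pderiv (pderiv B) - smult (2 * of_nat n) (pderiv B)) =
      smult (of_nat n * (of_nat n + 1)) B"
    using ode by (simp only: node_ode_def B_def n_def)
  then have "[:1, -1:] * [:0, 1:] * pderiv (pderiv B) =
      smult (of_nat n * (of_nat n + 1)) B + [:1, -1:] * smult (2 * of_nat n) (pderiv B)"
    by (simp only: right_diff_distrib mult.assoc) (simp only: diff_eq_eq)
  moreover have "d ^ Suc k dvd B" "d ^ Suc k dvd pderiv B"
    unfolding d_def order_divides using ord by auto
  moreover have P: "[:1, -1:] * [:0, 1:] * pderiv (pderiv B) \<noteq> 0"
    using ddB by (simp only: mult_eq_0_iff pCons_eq_0_iff) simp
  ultimately have "d ^ Suc k dvd [:1, -1:] * [:0, 1:] * pderiv (pderiv B)"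
    by (metis dvd_add dvd_smult dvd_mult)
  then have "Suc k \<le> order s ([:1, -1:] * [:0, 1:] * pderiv (pderiv B))"
    using P unfolding d_def order_divides by blast
  also have "\<dots> = k"
  proof -
    have Q: "[:1, -1:] * [:0, 1::complex:] \<noteq> 0" by simp
    have "order s [:1, -1:] = 0" "order s [:0, 1:] = 0"
      using s by (auto intro!: order_0I)
    then show ?thesis unfolding order_mult[OF P] order_mult[OF Q] by (simp add: k_def)
  qed
  finally show False by simp
qed

text \<open>
  The logarithmic derivative again, now as a rational function at a given point.
\<close>
lemma poly_pderiv_recip_poly:
  assumes "poly (recip_poly V) s \<noteq> 0"
  shows "poly (pderiv (recip_poly V)) s = - poly (recip_poly V) s * (\<Sum>v\<in>#V. v / (1 - v * s))"
  using assms
proof (induction V)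
  case (add v V)
  then have nz: "1 - v * s \<noteq> 0" "poly (recip_poly V) s \<noteq> 0" by (auto simp: algebra_simps)
  have der: "poly (pderiv (recip_poly (add_mset v V))) s =
      - v * poly (recip_poly V) s + (1 - v * s) * poly (pderiv (recip_poly V)) s"
    unfolding recip_poly_add pderiv_mult poly_add poly_mult by (simp add: pderiv_pCons algebra_simps)
  have "poly (recip_poly (add_mset v V)) s = (1 - v * s) * poly (recip_poly V) s"
    by (simp add: algebra_simps)
  with nz(1) show ?case
    unfolding der add.IH[OF nz(2)] by (simp add: field_simps)
qed simp

text \<open>
  Write \<open>B = (1 - w s) T\<close>.  At \<open>s = 1 / w\<close> the first two derivatives of \<open>B\<close> are \<open>- w T\<close> and \<open>- 2 w T'\<close>,
  so the equation determines \<open>T' / T = n / s\<close> there.  Expressing \<open>T' / T\<close> by the other nodes gives the sum of forces.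
\<close>
lemma node_equilibrium:
  assumes ode: "node_ode (add_mset w V)" and w: "w \<noteq> 0" "w \<noteq> 1"
  shows "w \<notin># V" and "(\<Sum>v\<in>#V. 1 / (v - w)) = 1 / w"
proof -
  define s where "s = 1 / w"
  define n where "n = size (add_mset w V)"
  define T where "T = recip_poly V"
  define B where "B = recip_poly (add_mset w V)"
  have T: "poly T s \<noteq> 0" unfolding T_def s_def by (rule node_ode_simple[OF assms])
  have s: "s \<noteq> 0" "s \<noteq> 1" "w * s = 1" using w by (auto simp: s_def)
  have "poly (recip_poly V) s = (\<Prod>v\<in>#V. 1 - v * s)"
    by (induction V) (simp_all add: algebra_simps)
  then have "(\<Prod>v\<in>#V. 1 - v * s) \<noteq> 0" using T T_def by simp
  then show wV: "w \<notin># V" using s by (auto simp: prod_mset_zero_iff)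
  have B: "B = [:1, -w:] * T" by (simp add: B_def T_def)
  have pB: "pderiv B = [:1, -w:] * pderiv T - smult w T"
    unfolding B pderiv_mult by (simp add: pderiv_pCons)
  have ppB: "pderiv (pderiv B) = [:1, -w:] * pderiv (pderiv T) + pderiv T * [:-w:] - smult w (pderiv T)"
    unfolding pB pderiv_diff pderiv_mult pderiv_smult by (simp add: pderiv_pCons)
  have dB: "poly (pderiv B) s = - w * poly T s" "poly (pderiv (pderiv B)) s = - 2 * w * poly (pderiv T) s" "poly B s = 0"
    unfolding ppB unfolding pB unfolding B poly_diff poly_add poly_mult poly_smult using s by (simp_all add: mult.commute)
  have "poly ([:1, -1:] * ([:0, 1:] * pderiv (pderiv B) - smult (2 * of_nat n) (pderiv B))) s =
      poly (smult (of_nat n * (of_nat n + 1)) B) s"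
    using ode by (simp only: node_ode_def B_def n_def)
  then have "(1 - s) * (s * poly (pderiv (pderiv B)) s - 2 * of_nat n * poly (pderiv B) s) = 0"
    unfolding poly_mult poly_diff poly_smult dB(3) by simp
  then have "s * poly (pderiv (pderiv B)) s - 2 * of_nat n * poly (pderiv B) s = 0"
    using s(2) by simp
  then have "2 * w * (of_nat n * poly T s - s * poly (pderiv T) s) = 0"
    unfolding dB by (simp add: algebra_simps)
  then have "of_nat n * poly T s = s * poly (pderiv T) s" using w by simp
  also have "poly (pderiv T) s = - poly T s * (\<Sum>v\<in>#V. v / (1 - v * s))"
    using T unfolding T_def by (rule poly_pderiv_recip_poly)
  finally have "poly T s * of_nat n = poly T s * (- s * (\<Sum>v\<in>#V. v / (1 - v * s)))"
    by (simp add: mult_ac)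
  then have "of_nat n = - s * (\<Sum>v\<in>#V. v / (1 - v * s))"
    using T mult_left_cancel by blast
  also have "\<dots> = (\<Sum>v\<in>#V. 1 + w / (v - w))"
    unfolding sum_mset_distrib_left
  proof (intro arg_cong[of _ _ sum_mset] image_mset_cong)
    fix v assume "v \<in># V"
    then have "v \<noteq> w" using wV by auto
    then show "- s * (v / (1 - v * s)) = 1 + w / (v - w)"
      using w by (simp add: s_def divide_simps) (simp add: algebra_simps)
  qed
  also have "\<dots> = of_nat (size V) + w * (\<Sum>v\<in>#V. 1 / (v - w))"
    by (simp add: sum_mset.distrib sum_mset_distrib_left)
  finally show "(\<Sum>v\<in>#V. 1 / (v - w)) = 1 / w"
    using w by (simp add: n_def field_simps)
qed

lemma Re_sum_mset: "Re (\<Sum>v\<in>#V. f v) = (\<Sum>v\<in>#V. Re (f v))"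
  by (induction V) simp_all

lemma sum_mset_nonpos: "(\<And>v. v \<in># V \<Longrightarrow> f v \<le> 0) \<Longrightarrow> (\<Sum>v\<in>#V. f v) \<le> (0::real)"
  by (induction V) (auto intro: add_nonpos_nonpos)

text \<open>
  Suppose the linear functional \<open>Re (cnj c * z)\<close> takes, on the nodes, a value greater than at \<open>0\<close> and at
  \<open>1\<close>, and let \<open>w\<close> be a node where it is maximal.  For every other node \<open>v\<close>, the number \<open>Re (c / (v - w))\<close>
  has the sign of the functional at \<open>v - w\<close>, which is not positive, while \<open>Re (c / w)\<close> is positive.
  This contradicts the equilibrium at \<open>w\<close>.
\<close>
lemma node_support:
  assumes ode: "node_ode U" and nz: "0 \<notin># U" and u: "u \<in># U"
  shows "Re (cnj c * u) \<le> max 0 (Re c)"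
proof (rule ccontr)
  define l where "l z = Re (cnj c * z)" for z
  assume "\<not> ?thesis"
  then have lu: "l u > 0" "l u > Re c" by (auto simp: l_def)
  have "finite (l ` set_mset U)" "l ` set_mset U \<noteq> {}" using u by auto
  then obtain w where w: "w \<in># U" "\<And>v. v \<in># U \<Longrightarrow> l v \<le> l w"
    by (metis (mono_tags, lifting) Max_ge Max_in imageE imageI)
  \<comment> \<open>\<open>l 1 = Re c\<close>, so \<open>w\<close> is neither \<open>0\<close> nor \<open>1\<close>.\<close>
  have lw: "l w > 0" "l w > Re c" using lu w(2)[OF u] by auto
  then have w01: "w \<noteq> 0" "w \<noteq> 1" by (auto simp: l_def)
  obtain V where U: "U = add_mset w V" using w(1) by (metis multi_member_split)
  have Re_div: "Re (c * (1 / z)) = l z / (cmod z)\<^sup>2" for z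
    unfolding l_def times_divide_eq_right mult_1_right complex_div_cnj[of c z]
    by (simp add: algebra_simps flip: of_real_power)
  have "(\<Sum>v\<in>#V. Re (c * (1 / (v - w)))) \<le> 0"
  proof (rule sum_mset_nonpos)
    fix v assume "v \<in># V"
    then have "l (v - w) \<le> 0" using w(2)[of v] by (simp add: U l_def algebra_simps)
    then show "Re (c * (1 / (v - w))) \<le> 0" unfolding Re_div by (simp add: divide_nonpos_nonneg)
  qed
  then have "Re (c * (\<Sum>v\<in>#V. 1 / (v - w))) \<le> 0"
    unfolding sum_mset_distrib_left Re_sum_mset .
  moreover have "Re (c * (1 / w)) > 0"
    unfolding Re_div using lw w01 by simp
  ultimately show False
    using node_equilibrium(2)[OF ode[unfolded U] w01] by (simp only:)
qed

text \<open>
  The four half-planes given by \<open>c = 1, -1, \<i>, -\<i>\<close> intersect in the unit interval.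
\<close>
lemma node_in_unit_interval:
  assumes ode: "node_ode U" and nz: "0 \<notin># U" and u: "u \<in># U"
  shows "u \<in> complex_of_real ` {0..1}"
proof -
  note S = node_support[OF assms]
  have "Re u \<le> 1" "Re u \<ge> 0" "Im u = 0"
    using S[of 1] S[of "-1"] S[of \<i>] S[of "-\<i>"] by auto
  then show ?thesis by (auto intro!: image_eqI[of _ _ "Re u"] complex_eqI)
qed

section \<open>The limit law and its moments\<close>

definition limit_cdf :: "real \<Rightarrow> real" where
  "limit_cdf x = 1 - 2 / pi * arctan (sqrt (- x))"

definition limit_density :: "real \<Rightarrow> real" where
  "limit_density x = (if x < 0 then 1 / pi * (1 / ((1 - x) * sqrt (- x))) else 0)"

definition limit_measure :: "real measure" where
  "limit_measure = density lborel (\<lambda>x. ennreal (limit_density x))"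

lemma limit_density_nonneg [simp]: "limit_density x \<ge> 0"
  by (simp add: limit_density_def)

lemma limit_density_measurable [measurable]: "limit_density \<in> borel_measurable borel"
  unfolding limit_density_def[abs_def] by measurable

lemma sets_limit_measure [measurable_cong, simp]: "sets limit_measure = sets borel"
  and space_limit_measure [simp]: "space limit_measure = UNIV"
  by (simp_all add: limit_measure_def)

lemma isCont_limit_density: "x < 0 \<Longrightarrow> isCont limit_density x"
proof -
  assume x: "x < 0"
  have "isCont (\<lambda>x::real. 1 / pi * (1 / ((1 - x) * sqrt (- x)))) x"
    using x by (intro continuous_intros) auto
  moreover have "eventually (\<lambda>y. limit_density y = 1 / pi * (1 / ((1 - y) * sqrt (- y)))) (nhds x)"
    using eventually_nhds_in_open[of "{..<0}" x] x
    by (auto elim!: eventually_mono simp: limit_density_def)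
  ultimately show ?thesis by (simp add: isCont_cong)
qed

lemma DERIV_sqrt_uminus: "x < 0 \<Longrightarrow> ((\<lambda>x. sqrt (- x)) has_real_derivative - (1 / (2 * sqrt (- x)))) (at x)"
  by (auto intro!: derivative_eq_intros simp: field_simps)

lemma DERIV_limit_cdf:
  assumes "x < 0"
  shows "(limit_cdf has_real_derivative limit_density x) (at x)"
proof -
  have "(limit_cdf has_real_derivative - (2 / pi * (inverse (1 + (sqrt (- x))\<^sup>2) * (- (1 / (2 * sqrt (- x))))))) (at x)"
    unfolding limit_cdf_def[abs_def] 
    by (rule derivative_eq_intros DERIV_sqrt_uminus assms refl DERIV_chain2[OF DERIV_arctan])+ simp
  also have "- (2 / pi * (inverse (1 + (sqrt (- x))\<^sup>2) * (- (1 / (2 * sqrt (- x)))))) = limit_density x"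
    using assms by (simp add: limit_density_def field_simps)
  finally show ?thesis .
qed

lemma limit_cdf_at_bot: "(limit_cdf \<longlongrightarrow> 0) at_bot"
proof -
  have "((\<lambda>x. arctan (sqrt (- x))) \<longlongrightarrow> pi / 2) at_bot"
    by (rule filterlim_compose[OF tendsto_arctan_at_top]
        filterlim_compose[OF sqrt_at_top] filterlim_uminus_at_top_at_bot)+
  then have "(limit_cdf \<longlongrightarrow> 1 - 2 / pi * (pi / 2)) at_bot"
    unfolding limit_cdf_def[abs_def] by (intro tendsto_intros)
  then show ?thesis by simp
qed

lemma isCont_limit_cdf: "isCont limit_cdf x"
  unfolding limit_cdf_def[abs_def] by (intro continuous_intros)

lemma limit_density_integral:
  assumes "b \<le> 0"
  shows "set_integrable lborel {..<b} limit_density" "(LINT x:{..<b}|lborel. limit_density x) = limit_cdf b"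
proof -
  have e: "einterval (-\<infinity>) (ereal b) = {..<b}" by (auto simp: einterval_def)
  have prem: "- \<infinity> < ereal b"
    "\<And>x. - \<infinity> < ereal x \<Longrightarrow> ereal x < ereal b \<Longrightarrow> (limit_cdf has_real_derivative limit_density x) (at x)"
    "\<And>x. - \<infinity> < ereal x \<Longrightarrow> ereal x < ereal b \<Longrightarrow> isCont limit_density x"
    "AE x in lborel. - \<infinity> < ereal x \<longrightarrow> ereal x < ereal b \<longrightarrow> 0 \<le> limit_density x"
    "((limit_cdf \<circ> real_of_ereal) \<longlongrightarrow> 0) (at_right (-\<infinity>))"
    "((limit_cdf \<circ> real_of_ereal) \<longlongrightarrow> limit_cdf b) (at_left (ereal b))"
    using assms limit_cdf_at_bot
      tendsto_within_subset[OF isCont_limit_cdf[of b, unfolded isCont_def], of "{..<b}"]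
    by (simp_all add: ereal_tendsto_simps DERIV_limit_cdf isCont_limit_density)
  note I = interval_integral_FTC_nonneg[OF prem]
  show "set_integrable lborel {..<b} limit_density" using I(1) by (simp add: e)
  show "(LINT x:{..<b}|lborel. limit_density x) = limit_cdf b"
    using I(2) by (simp add: interval_lebesgue_integral_def e)
qed

lemma emeasure_limit_measure_atMost:
  assumes "b \<le> 0"
  shows "emeasure limit_measure {..b} = ennreal (limit_cdf b)"
proof -
  have "emeasure limit_measure {..b} = (\<integral>\<^sup>+x. ennreal (limit_density x) * indicator {..b} x \<partial>lborel)"
    unfolding limit_measure_def by (rule emeasure_density) simp_all
  also have "\<dots> = (\<integral>\<^sup>+x. ennreal (indicator {..<b} x * limit_density x) \<partial>lborel)"
    using AE_lborel_singleton[of b]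
    by (intro nn_integral_cong_AE) (auto elim!: eventually_mono simp: indicator_def)
  also have "\<dots> = ennreal (\<integral>x. indicator {..<b} x * limit_density x \<partial>lborel)"
    using limit_density_integral(1)[OF assms]
    by (intro nn_integral_eq_integral) (auto simp: set_integrable_def)
  also have "(\<integral>x. indicator {..<b} x * limit_density x \<partial>lborel) = limit_cdf b"
    using limit_density_integral(2)[OF assms] by (simp add: set_lebesgue_integral_def)
  finally show ?thesis .
qed

lemma AE_limit_measure: "AE x in limit_measure. x < 0"
  unfolding limit_measure_def by (subst AE_density) (auto simp: limit_density_def)

lemma prob_space_limit_measure: "prob_space limit_measure"
proof
  have "emeasure limit_measure UNIV = emeasure limit_measure {..0}"
    using AE_limit_measure by (intro emeasure_eq_AE) auto
  also have "\<dots> = 1" by (simp add: emeasure_limit_measure_atMost limit_cdf_def)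
  finally show "emeasure limit_measure (space limit_measure) = 1" by simp
qed

text \<open>
  The quotient of \<open>sqrt (- x)\<close> by the power \<open>k + 1\<close> of \<open>1 - x\<close> vanishes at \<open>0\<close> and at
  minus infinity, so its derivative has integral zero.  With \<open>u = 1 / (1 - x)\<close>, this derivative is
  \<open>pi\<close> times the density times \<open>(k + 1/2) u\<^sup>k - (k + 1) u\<^sup>k\<^sup>+\<^sup>1\<close>, which gives the recurrence
  \<open>arcsine_moment_Suc\<close>.
\<close>
lemma limit_moments:
  "(\<integral>x. (1 / (1 - x)) ^ k \<partial>limit_measure) = arcsine_moment k"
proof (induction k)
  case 0
  interpret prob_space limit_measure by (rule prob_space_limit_measure)
  show ?case using prob_space by simp
next
  case (Suc k)
  interpret prob_space limit_measure by (rule prob_space_limit_measure)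
  define u where "u x = 1 / (1 - x)" for x :: real
  define g where "g x = (k + 1/2) * u x ^ k - (k + 1) * u x ^ Suc k" for x
  define h where "h x = sqrt (- x) * u x ^ Suc k" for x
  have u01: "0 \<le> u x" "u x \<le> 1" if "x < 0" for x using that by (auto simp: u_def)
  have [measurable]: "u \<in> borel_measurable borel" unfolding u_def[abs_def] by measurable
  have pow: "\<bar>u x ^ j\<bar> \<le> 1" if "x < 0" for x j
    using u01[OF that] by (simp add: power_le_one)
  have int: "integrable limit_measure (\<lambda>x. u x ^ j)" for j
    using AE_limit_measure
    by (intro integrable_const_bound[of _ 1]) (auto elim!: eventually_mono simp: pow[simplified])
  then have intg: "integrable limit_measure g"
    unfolding g_def by (intro Bochner_Integration.integrable_diff integrable_mult_right)
  have meas[measurable]: "g \<in> borel_measurable borel" unfolding g_def by measurable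
  have eq: "(\<lambda>x. indicator {..<0} x *\<^sub>R (limit_density x * g x)) = (\<lambda>x. limit_density x *\<^sub>R g x)"
    by (auto simp: limit_density_def)
  have dens: "integrable lborel (\<lambda>x. limit_density x *\<^sub>R g x)"
    using intg unfolding limit_measure_def by (subst (asm) integrable_density) auto
  have e: "einterval (-\<infinity>) (ereal 0) = {..<0}" by (auto simp: einterval_def)
  have hbot: "(h \<longlongrightarrow> 0) at_bot"
  proof (rule tendsto_sandwich)
    show "eventually (\<lambda>x. 0 \<le> h x) at_bot"
      using eventually_gt_at_bot[of "0::real"] by eventually_elim (simp add: h_def u01)
    show "eventually (\<lambda>x. h x \<le> 1 / sqrt (1 - x)) at_bot"
      using eventually_gt_at_bot[of "0::real"]
    proof eventually_elim
      case (elim x)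
      have "u x ^ Suc k \<le> u x" using u01[OF elim] by (simp add: mult_left_le power_le_one)
      then have "h x \<le> sqrt (1 - x) * u x"
        unfolding h_def using u01[OF elim] elim by (intro mult_mono) auto
      also have "\<dots> = 1 / sqrt (1 - x)"
        using elim by (simp add: u_def field_simps flip: power2_eq_square)
      finally show ?case .
    qed
    have "filterlim (\<lambda>x::real. 1 + (- x)) at_top at_bot"
      by (intro filterlim_tendsto_add_at_top[OF tendsto_const] filterlim_uminus_at_top_at_bot)
    then have "filterlim (\<lambda>x::real. sqrt (1 - x)) at_top at_bot"
      using filterlim_compose[OF sqrt_at_top] by simp
    then show "((\<lambda>x. 1 / sqrt (1 - x)) \<longlongrightarrow> 0) at_bot"
      by (intro tendsto_divide_0[OF tendsto_const] filterlim_at_top_imp_at_infinity)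
  qed (rule tendsto_const)
  have "isCont h 0" unfolding h_def u_def by (intro continuous_intros) auto
  then have h0: "(h \<longlongrightarrow> 0) (at_left 0)"
    by (auto simp: isCont_def h_def intro: tendsto_within_subset)
  have "(LBINT x=-\<infinity>..ereal 0. limit_density x * g x) = 0 / pi - 0 / pi"
  proof (rule interval_integral_FTC_integrable[where F = "\<lambda>x. h x / pi"])
    fix x assume "ereal x < ereal 0"
    then have x: "x < 0" by simp
    have du: "(u has_real_derivative (u x)\<^sup>2) (at x)"
      unfolding u_def[abs_def] using x by (auto intro!: derivative_eq_intros simp: power2_eq_square field_simps)
    have "((\<lambda>x. h x / pi) has_real_derivative
        (- (1 / (2 * sqrt (- x))) * u x ^ Suc k + real (Suc k) * (u x ^ k * (u x)\<^sup>2) * sqrt (- x)) / pi) (at x)"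
      using DERIV_cdivide[OF DERIV_mult[OF DERIV_sqrt_uminus[OF x] DERIV_power[OF du, of "Suc k"]], of pi]
      unfolding h_def by (simp only: diff_Suc_Suc diff_zero mult.commute[of "(u x)\<^sup>2"])
    also have "(- (1 / (2 * sqrt (- x))) * u x ^ Suc k + real (Suc k) * (u x ^ k * (u x)\<^sup>2) * sqrt (- x)) / pi =
        limit_density x * g x"
    proof -
      define r where "r = sqrt (- x)"
      have r: "r > 0" "1 - u x = r * r * u x"
        using x by (auto simp: u_def r_def field_simps)
      have ld: "limit_density x = u x / r / pi"
        using x by (simp add: limit_density_def u_def r_def)
      have gx: "g x = u x ^ k * ((real k + 1) * (r * r * u x) - 1 / 2)"
        unfolding r(2)[symmetric] by (simp add: g_def algebra_simps)
      show ?thesis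
        unfolding ld gx r_def[symmetric] using r(1) by (simp add: field_simps power2_eq_square)
    qed
    finally show "((\<lambda>x. h x / pi) has_vector_derivative limit_density x * g x) (at x)"
      by (simp add: has_real_derivative_iff_has_vector_derivative)
    show "isCont (\<lambda>x. limit_density x * g x) x"
      unfolding g_def u_def using x by (intro continuous_intros isCont_limit_density) auto
  next
    show "set_integrable lborel (einterval (-\<infinity>) (ereal 0)) (\<lambda>x. limit_density x * g x)"
      unfolding e set_integrable_def eq by (rule dens)
    show "(((\<lambda>x. h x / pi) \<circ> real_of_ereal) \<longlongrightarrow> 0 / pi) (at_right (-\<infinity>))"
      using hbot unfolding ereal_tendsto_simps by (intro tendsto_divide) auto
    show "(((\<lambda>x. h x / pi) \<circ> real_of_ereal) \<longlongrightarrow> 0 / pi) (at_left (ereal 0))"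
      using h0 unfolding ereal_tendsto_simps by (intro tendsto_divide) auto
  qed simp
  then have "(\<integral>x. limit_density x *\<^sub>R g x \<partial>lborel) = 0"
    by (simp add: interval_lebesgue_integral_def e set_lebesgue_integral_def eq[simplified])
  then have "(\<integral>x. g x \<partial>limit_measure) = 0"
    unfolding limit_measure_def by (subst integral_density) auto
  also have "(\<integral>x. g x \<partial>limit_measure) =
      (k + 1/2) * (\<integral>x. u x ^ k \<partial>limit_measure) - (k + 1) * (\<integral>x. u x ^ Suc k \<partial>limit_measure)"
    unfolding g_def using int[of k] int[of "Suc k"] by (subst Bochner_Integration.integral_diff) auto
  finally have "(real k + 1) * (\<integral>x. u x ^ Suc k \<partial>limit_measure) = (real k + 1) * arcsine_moment (Suc k)"
    unfolding arcsine_moment_Suc using Suc.IH by (simp add: u_def)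
  moreover have "real k + 1 \<noteq> 0" by simp
  ultimately have "(\<integral>x. u x ^ Suc k \<partial>limit_measure) = arcsine_moment (Suc k)"
    using mult_left_cancel by blast
  then show ?case unfolding u_def .
qed

section \<open>Test functions determine a measure\<close>

text \<open>
  The standard smooth function that is flat at \<open>0\<close>, with a polynomial factor in \<open>1 / x\<close> that makes
  the family closed under differentiation.
\<close>
definition flat_exp :: "real poly \<Rightarrow> real \<Rightarrow> real" where
  "flat_exp p x = (if x > 0 then poly p (inverse x) * exp (- inverse x) else 0)"

lemma poly_exp_tendsto_0: "((\<lambda>y. poly p y * exp (- y)) \<longlongrightarrow> (0::real)) at_top"
proof -
  have "((\<lambda>y. \<Sum>i\<le>degree p. coeff p i * (y ^ i / exp y)) \<longlongrightarrow> (\<Sum>i\<le>degree p. coeff p i * 0)) at_top"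
    by (intro tendsto_intros tendsto_power_div_exp_0)
  then show ?thesis
    by (simp add: poly_altdef exp_minus sum_divide_distrib field_simps)
qed

text \<open>
  At \<open>0\<close> the difference quotient is again a function of this family, and it tends to \<open>0\<close> from the
  right because the exponential beats every polynomial in \<open>1 / x\<close>.
\<close>
lemma DERIV_flat_exp:
  "(flat_exp p has_real_derivative flat_exp ([:0, 0, 1:] * (p - pderiv p)) x) (at x)"
proof -
  consider "x < 0" | "x = 0" | "x > 0" by linarith
  then show ?thesis
  proof cases
    case 1
    have "eventually (\<lambda>y. flat_exp p y = 0) (nhds x)"
      using eventually_nhds_in_open[of "{..<0}" x] 1 by (auto elim!: eventually_mono simp: flat_exp_def)
    then have "(flat_exp p has_real_derivative 0) (at x)"
      using DERIV_cong_ev[OF refl _ refl, of "flat_exp p" "\<lambda>_. 0" x 0] by simp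
    with 1 show ?thesis by (simp add: flat_exp_def)
  next
    case 2
    have "((\<lambda>h. flat_exp p h / h) \<longlongrightarrow> 0) (at_left 0)"
      by (rule tendsto_eventually) (auto simp: eventually_at_filter flat_exp_def)
    moreover have "((\<lambda>h. flat_exp p h / h) \<longlongrightarrow> 0) (at_right 0)"
    proof (rule Lim_transform_eventually)
      show "((\<lambda>h. poly (pCons 0 p) (inverse h) * exp (- inverse h)) \<longlongrightarrow> (0::real)) (at_right 0)"
        by (rule filterlim_compose[OF poly_exp_tendsto_0 filterlim_inverse_at_top_right])
      show "eventually (\<lambda>h. poly (pCons 0 p) (inverse h) * exp (- inverse h) = flat_exp p h / h) (at_right 0)"
        by (auto simp: eventually_at_filter flat_exp_def field_simps)
    qed
    ultimately have "((\<lambda>h. flat_exp p h / h) \<longlongrightarrow> 0) (at 0)"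
      by (rule filterlim_split_at)
    then show ?thesis by (simp add: DERIV_def 2) (simp add: flat_exp_def)
  next
    case 3
    have ev: "eventually (\<lambda>y. flat_exp p y = poly p (inverse y) * exp (- inverse y)) (nhds x)"
      using eventually_nhds_in_open[of "{0<..}" x] 3 by (auto elim!: eventually_mono simp: flat_exp_def)
    moreover have "((\<lambda>y. poly p (inverse y) * exp (- inverse y)) has_real_derivative
        flat_exp ([:0, 0, 1:] * (p - pderiv p)) x) (at x)"
      using 3 by (auto intro!: derivative_eq_intros simp: flat_exp_def power2_eq_square algebra_simps)
    ultimately show ?thesis
      using DERIV_cong_ev[OF refl ev refl] by blast
  qed
qed

text \<open>
  Smoothness asks for all iterated directional derivatives.  An algebra of differentiable functions that is
  closed under directional derivatives makes this an induction on the list of directions.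
\<close>
inductive bump_algebra :: "('a::real_normed_vector \<Rightarrow> real) \<Rightarrow> bool" where
  const: "bump_algebra (\<lambda>_. c)"
| flat: "bounded_linear l \<Longrightarrow> bump_algebra (\<lambda>z. flat_exp p (l z + a))"
| add: "bump_algebra f \<Longrightarrow> bump_algebra g \<Longrightarrow> bump_algebra (\<lambda>z. f z + g z)"
| mult: "bump_algebra f \<Longrightarrow> bump_algebra g \<Longrightarrow> bump_algebra (\<lambda>z. f z * g z)"

lemma bump_algebra_derivative:
  "bump_algebra f \<Longrightarrow> \<exists>f'. (\<forall>z. (f has_derivative f' z) (at z)) \<and> (\<forall>v. bump_algebra (\<lambda>z. f' z v))"
proof (induction rule: bump_algebra.induct)
  case (const c)
  show ?case by (rule exI[of _ "\<lambda>_ _. 0"]) (auto intro: bump_algebra.const)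
next
  case (flat l p a)
  interpret l: bounded_linear l by fact
  define q where "q = [:0, 0, 1:] * (p - pderiv p)"
  have "((\<lambda>z. flat_exp p (l z + a)) has_derivative (\<lambda>v. flat_exp q (l z + a) * l v)) (at z)" for z
  proof -
    have 1: "((\<lambda>z. l z + a) has_derivative l) (at z)"
      using l.has_derivative[OF has_derivative_ident] by (auto intro!: derivative_eq_intros)
    have 2: "(flat_exp p has_derivative (\<lambda>h. flat_exp q (l z + a) * h)) (at (l z + a))"
      using DERIV_flat_exp[of p "l z + a"] by (simp add: q_def has_field_derivative_def)
    show ?thesis by (rule has_derivative_compose[OF 1 2])
  qed
  moreover have "bump_algebra (\<lambda>z. flat_exp q (l z + a) * l v)" for v
    by (intro bump_algebra.mult bump_algebra.flat bump_algebra.const flat)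
  ultimately show ?case by (intro exI[of _ "\<lambda>z v. flat_exp q (l z + a) * l v"]) blast
next
  case (add f g)
  then obtain f' g' where d: "\<And>z. (f has_derivative f' z) (at z)" "\<And>z. (g has_derivative g' z) (at z)"
    and b: "\<And>v. bump_algebra (\<lambda>z. f' z v)" "\<And>v. bump_algebra (\<lambda>z. g' z v)" by metis
  show ?case
    by (rule exI[of _ "\<lambda>z v. f' z v + g' z v"])
       (use d b in \<open>auto intro!: has_derivative_add bump_algebra.add\<close>)
next
  case (mult f g)
  then obtain f' g' where d: "\<And>z. (f has_derivative f' z) (at z)" "\<And>z. (g has_derivative g' z) (at z)"
    and b: "\<And>v. bump_algebra (\<lambda>z. f' z v)" "\<And>v. bump_algebra (\<lambda>z. g' z v)" by metis
  show ?case
    by (rule exI[of _ "\<lambda>z v. f z * g' z v + f' z v * g z"])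
       (use d b mult in \<open>auto intro!: has_derivative_mult bump_algebra.add bump_algebra.mult\<close>)
qed

lemma bump_algebra_imp_smooth:
  assumes "bump_algebra f"
  shows "smooth f"
  unfolding smooth_def
proof
  fix vs
  have "bump_algebra (foldr (\<lambda>v g z. frechet_derivative g (at z) v) vs f)"
  proof (induction vs)
    case (Cons v vs)
    let ?g = "foldr (\<lambda>v g z. frechet_derivative g (at z) v) vs f"
    obtain g' where g': "\<And>z. (?g has_derivative g' z) (at z)" "\<And>v. bump_algebra (\<lambda>z. g' z v)"
      using bump_algebra_derivative[OF Cons.IH] by metis
    have "frechet_derivative ?g (at z) = g' z" for z
      using frechet_derivative_at[OF g'(1)] by simp
    with g'(2) show ?case by simp
  qed (simp add: assms)
  then show "foldr (\<lambda>v g z. frechet_derivative g (at z) v) vs f differentiable_on UNIV"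
    using bump_algebra_derivative by (fastforce simp: differentiable_on_def differentiable_def)
qed

lemma bump_algebra_prod:
  assumes "finite I" "\<And>i. i \<in> I \<Longrightarrow> bump_algebra (f i)"
  shows "bump_algebra (\<lambda>z. \<Prod>i\<in>I. f i z)"
  using assms by (induction I) (auto intro: bump_algebra.intros)

lemma bump_algebra_power: "bump_algebra f \<Longrightarrow> bump_algebra (\<lambda>z. f z ^ k)"
  by (induction k) (auto intro: bump_algebra.intros)

lemma smooth_imp_continuous:
  assumes "smooth f" shows "continuous_on UNIV f"
proof -
  have "f differentiable_on UNIV"
    using assms unfolding smooth_def by (elim allE[of _ "[]"]) simp
  then show ?thesis by (rule differentiable_imp_continuous_on)
qed

lemma flat_1_bounds: "0 \<le> flat_exp 1 x" "flat_exp 1 x \<le> 1" "flat_exp 1 x > 0 \<longleftrightarrow> x > 0"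
  by (auto simp: flat_exp_def)

text \<open>
  Let \<open>h\<close> be the product, over all coordinates, of flat functions that are positive exactly between the two
  faces of the box.  It is bounded by \<open>1\<close>, and \<open>1 - (1 - h)\<^sup>k\<close> tends to \<open>1\<close> where \<open>h > 0\<close> and is \<open>0\<close> elsewhere.
\<close>
lemma box_indicator_approximation:
  fixes a b :: "'a::euclidean_space"
  obtains \<phi> :: "nat \<Rightarrow> 'a \<Rightarrow> real" where
    "\<And>k. test_function (\<phi> k)" "\<And>k z. \<bar>\<phi> k z\<bar> \<le> indicator (cbox a b) z"
    "\<And>z. (\<lambda>k. \<phi> k z) \<longlonglongrightarrow> indicator (box a b) z"
proof
  define h where "h z = (\<Prod>i\<in>Basis. flat_exp 1 (z \<bullet> i + - (a \<bullet> i)) * flat_exp 1 ((- z) \<bullet> i + b \<bullet> i))" for z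
  define \<phi> where "\<phi> k z = 1 + (-1) * (1 + (-1) * h z) ^ k" for k :: nat and z
  have lin: "bounded_linear (\<lambda>z::'a. z \<bullet> i)" "bounded_linear (\<lambda>z::'a. (- z) \<bullet> i)" for i
    by (auto intro: bounded_linear_inner_left bounded_linear_minus bounded_linear_compose[OF bounded_linear_inner_left])
  have "bump_algebra h" unfolding h_def
    by (intro bump_algebra_prod finite_Basis bump_algebra.mult bump_algebra.flat lin)
  then have alg: "bump_algebra (\<phi> k)" for k
    unfolding \<phi>_def by (intro bump_algebra.add bump_algebra.mult bump_algebra_power bump_algebra.const)
  have h01: "0 \<le> h z" "h z \<le> 1" for z
    unfolding h_def by (auto intro!: prod_nonneg prod_le_1 mult_nonneg_nonneg mult_le_one simp: flat_1_bounds)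
  have hpos: "h z > 0 \<longleftrightarrow> z \<in> box a b" for z
  proof -
    have "h z > 0 \<longleftrightarrow> (\<forall>i\<in>Basis. flat_exp 1 (z \<bullet> i + - (a \<bullet> i)) \<noteq> 0 \<and> flat_exp 1 ((- z) \<bullet> i + b \<bullet> i) \<noteq> 0)"
      using h01(1)[of z] unfolding less_le h_def by (auto simp: prod_zero_iff)
    also have "\<dots> \<longleftrightarrow> z \<in> box a b"
      using flat_1_bounds unfolding box_def less_le by (auto simp: algebra_simps)
    finally show ?thesis .
  qed
  then have h0: "h z = 0 \<longleftrightarrow> z \<notin> box a b" for z using h01(1)[of z] by (metis less_le)
  have \<phi>0: "\<phi> k z = 0" if "z \<notin> box a b" for k z using that h0[of z] by (simp add: \<phi>_def)
  show "test_function (\<phi> k)" for k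
    unfolding test_function_def
  proof
    show "smooth (\<phi> k)" by (rule bump_algebra_imp_smooth) (rule alg)
    have "{z. \<phi> k z \<noteq> 0} \<subseteq> box a b" using \<phi>0 by auto
    then show "compact (closure {z. \<phi> k z \<noteq> 0})"
      using bounded_subset[OF bounded_box] by (simp add: compact_closure)
  qed
  show "\<bar>\<phi> k z\<bar> \<le> indicator (cbox a b) z" for k z
  proof (cases "z \<in> box a b")
    case True
    then have "z \<in> cbox a b" using box_subset_cbox by auto
    moreover have "\<bar>\<phi> k z\<bar> \<le> 1" using h01[of z] power_le_one[of "1 - h z" k] by (simp add: \<phi>_def)
    ultimately show ?thesis by simp
  qed (simp add: \<phi>0)
  show "(\<lambda>k. \<phi> k z) \<longlonglongrightarrow> indicator (box a b) z" for z
  proof (cases "z \<in> box a b")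
    case True
    then have "(\<lambda>k. (1 - h z) ^ k) \<longlonglongrightarrow> 0"
      using h01[of z] hpos[of z] by (intro LIMSEQ_realpow_zero) auto
    then have "(\<lambda>k. 1 - (1 - h z) ^ k) \<longlonglongrightarrow> 1 - 0" by (rule tendsto_diff[OF tendsto_const])
    with True show ?thesis by (simp add: \<phi>_def)
  qed (simp add: \<phi>0)
qed

text \<open>
  By dominated convergence, integrals of test functions determine the measures of open boxes, which generate
  the Borel sets and are stable under intersection.  Finiteness on compact boxes provides the integrable bound.
\<close>
lemma radon_measure_eqI:
  fixes \<mu> \<nu> :: "'a::euclidean_space measure"
  assumes \<mu>: "radon_measure \<mu>" and \<nu>: "radon_measure \<nu>"
    and eq: "\<And>\<phi>. test_function \<phi> \<Longrightarrow> (\<integral>z. \<phi> z \<partial>\<mu>) = (\<integral>z. \<phi> z \<partial>\<nu>)"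
  shows "\<mu> = \<nu>"
proof -
  have sets: "sets M = sets borel" and fin: "emeasure M (cbox a b) < \<infinity>" if "radon_measure M" for M :: "'a measure" and a b
    using that compact_cbox unfolding radon_measure_def by blast+
  have fin_box: "emeasure M (box a b) < \<infinity>" if "radon_measure M" for M :: "'a measure" and a b
  proof -
    have "emeasure M (box a b) \<le> emeasure M (cbox a b)"
      by (intro emeasure_mono box_subset_cbox) (simp add: sets[OF that])
    then show ?thesis using fin[OF that, of a b] by (rule le_less_trans)
  qed
  have box: "emeasure \<mu> (box a b) = emeasure \<nu> (box a b)" for a b
  proof -
    obtain \<phi> :: "nat \<Rightarrow> 'a \<Rightarrow> real" where \<phi>: "\<And>k. test_function (\<phi> k)"
      "\<And>k z. \<bar>\<phi> k z\<bar> \<le> indicator (cbox a b) z" "\<And>z. (\<lambda>k. \<phi> k z) \<longlonglongrightarrow> indicator (box a b) z"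
      using box_indicator_approximation by metis
    have lim: "(\<lambda>k. \<integral>z. \<phi> k z \<partial>M) \<longlonglongrightarrow> measure M (box a b)" if M: "radon_measure M" for M
    proof -
      note [measurable_cong] = sets[OF M]
      have [measurable]: "\<phi> k \<in> borel_measurable borel" for k
        using \<phi>(1)[of k] unfolding test_function_def
        by (auto intro: borel_measurable_continuous_onI smooth_imp_continuous)
      have "(\<lambda>k. \<integral>z. \<phi> k z \<partial>M) \<longlonglongrightarrow> (\<integral>z. indicator (box a b) z \<partial>M)"
      proof (rule integral_dominated_convergence[where w = "indicator (cbox a b)"])
        show "integrable M (indicator (cbox a b) :: 'a \<Rightarrow> real)"
          using fin[OF M, of a b] by (intro integrable_real_indicator) (simp_all add: sets[OF M])
      qed (use \<phi>(2,3) in \<open>simp_all add: measurable_cong_sets[OF sets[OF M] refl]\<close>)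
      also have "(\<integral>z. indicator (box a b) z \<partial>M) = measure M (box a b)"
        using sets_eq_imp_space_eq[OF sets[OF M]] by simp
      finally show ?thesis .
    qed
    have "measure \<mu> (box a b) = measure \<nu> (box a b)"
      using LIMSEQ_unique[OF lim[OF \<mu>]] lim[OF \<nu>] eq[OF \<phi>(1)] by simp
    then show ?thesis
      using fin_box[OF \<mu>, of a b] fin_box[OF \<nu>, of a b]
      by (simp add: emeasure_eq_ennreal_measure less_top)
  qed
  have gen: "sets M = sigma_sets UNIV (range (\<lambda>(a, b). box a b :: 'a set))" if "radon_measure M" for M
    using sets[OF that] by (simp add: borel_eq_box)
  show ?thesis
  proof (rule measure_eqI_generator_eq[where A = "\<lambda>n. box (- (real n *\<^sub>R One)) (real n *\<^sub>R One)"])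
    show "Int_stable (range (\<lambda>(a, b). box a b :: 'a set))"
      by (auto simp: Int_stable_def box_Int_box)
    show "(\<Union>n. box (- (real n *\<^sub>R One)) (real n *\<^sub>R One) :: 'a set) = UNIV"
      by (rule UN_box_eq_UNIV)
    show "emeasure \<mu> (box (- (real n *\<^sub>R One)) (real n *\<^sub>R One)) \<noteq> \<infinity>" for n
      using fin_box[OF \<mu>] by (metis less_irrefl)
  qed (use gen \<mu> \<nu> box in auto)
qed

section \<open>Integrals against the root-counting measure\<close>

lemma sum_count_mult:
  assumes "finite A" "set_mset M \<subseteq> A"
  shows "(\<Sum>x\<in>A. of_nat (count M x) * f x) = (\<Sum>x\<in>#M. f x :: 'b::comm_semiring_1)"
  using assms(2)
proof (induction M)
  case (add y M)
  have "(\<Sum>x\<in>A. of_nat (count (add_mset y M) x) * f x) =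
      (\<Sum>x\<in>A. of_nat (count M x) * f x + (if x = y then f x else 0))"
    by (intro sum.cong) (auto simp: algebra_simps)
  also have "\<dots> = (\<Sum>x\<in>#add_mset y M. f x)"
    using add assms(1) by (simp add: sum.distrib add.commute)
  finally show ?case .
qed simp

text \<open>
  As the uniform distribution on the multiset of roots, the measure inherits the integration rules for
  finitely supported distributions.
\<close>
lemma root_counting_measure_eq_distr:
  assumes "degree p > 0"
  shows "root_counting_measure p = distr (measure_pmf (pmf_of_multiset (proots p))) borel (\<lambda>x. x)"
proof (rule measure_eqI)
  define U where "U = proots p"
  have U: "U \<noteq> {#}" "size U = degree p"
    using assms size_proots_complex[of p] by (auto simp: U_def)
  show s: "sets (root_counting_measure p) = sets (distr (measure_pmf (pmf_of_multiset (proots p))) borel (\<lambda>x. x))"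
    unfolding root_counting_measure_def
    by (metis sets.sigma_sets_eq sets_measure_of space_borel subset_UNIV Pow_UNIV sets_distr)
  fix A assume "A \<in> sets (root_counting_measure p)"
  then have A: "A \<in> sets borel" using s by simp
  have "emeasure (distr (measure_pmf (pmf_of_multiset U)) borel (\<lambda>x. x)) A = (\<integral>\<^sup>+x. indicator A x \<partial>measure_pmf (pmf_of_multiset U))"
    using A by (simp add: emeasure_distr)
  also have "\<dots> = (\<Sum>x\<in>set_mset U. indicator A x * ennreal (pmf (pmf_of_multiset U) x))"
    using U by (subst nn_integral_measure_pmf_finite) auto
  also have "\<dots> = (\<Sum>x\<in>set_mset U. of_nat (count U x) * indicator A x) / of_nat (degree p)"
    using U assms
  proof -
    have "ennreal (pmf (pmf_of_multiset U) x) = of_nat (count U x) / of_nat (degree p)" for x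
      using U assms by (simp add: divide_ennreal ennreal_of_nat_eq_real_of_nat)
    then show ?thesis by (simp only: divide_ennreal_def sum_distrib_left sum_distrib_right mult_ac)
  qed
  also have "\<dots> = (\<Sum>x\<in>#U. indicator A x) / of_nat (degree p)"
    by (subst sum_count_mult) auto
  also have "\<dots> = emeasure (root_counting_measure p) A"
    using A by (simp add: emeasure_root_counting_measure U_def)
  finally show "emeasure (root_counting_measure p) A =
      emeasure (distr (measure_pmf (pmf_of_multiset (proots p))) borel (\<lambda>x. x)) A"
    by (simp add: U_def)
qed

lemma integral_root_counting_measure:
  fixes f :: "complex \<Rightarrow> real"
  assumes "degree p > 0" and [measurable]: "f \<in> borel_measurable borel"
  shows "(\<integral>z. f z \<partial>root_counting_measure p) = (\<Sum>x\<in>#proots p. f x) / real (degree p)"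
proof -
  define U where "U = proots p"
  have U: "U \<noteq> {#}" "size U = degree p"
    using assms size_proots_complex[of p] by (auto simp: U_def)
  have "(\<integral>z. f z \<partial>root_counting_measure p) = (\<integral>z. f z \<partial>measure_pmf (pmf_of_multiset U))"
    unfolding root_counting_measure_eq_distr[OF assms(1)] U_def by (subst integral_distr) auto
  also have "\<dots> = (\<Sum>x\<in>set_mset U. pmf (pmf_of_multiset U) x * f x)"
    using U by (subst integral_measure_pmf[of "set_mset U"]) auto
  also have "\<dots> = (\<Sum>x\<in>set_mset U. of_nat (count U x) * f x) / real (degree p)"
    using U by (simp add: sum_divide_distrib)
  also have "\<dots> = (\<Sum>x\<in>#U. f x) / real (degree p)"
    by (subst sum_count_mult) auto
  finally show ?thesis by (simp add: U_def)
qed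

section \<open>Convergence of moments and weak convergence\<close>

text \<open>
  By Weierstrass, \<open>\<psi>\<close> is uniformly close to a polynomial on the unit interval, and the claim for
  polynomials is the convergence of moments.
\<close>
lemma method_of_moments:
  fixes V :: "nat \<Rightarrow> real multiset" and M :: "'a measure" and u :: "'a \<Rightarrow> real"
  assumes M: "prob_space M" and u[measurable]: "u \<in> borel_measurable M"
    and u01: "AE x in M. u x \<in> {0..1}"
    and V01: "\<And>n v. v \<in># V n \<Longrightarrow> v \<in> {0..1}"
    and size: "\<And>n. size (V n) = n"
    and moments: "\<And>k. (\<lambda>n. power_sum (V n) k / real n) \<longlonglongrightarrow> (\<integral>x. u x ^ k \<partial>M)"
    and cont: "continuous_on {0..1} \<psi>" and meas[measurable]: "\<psi> \<in> borel_measurable borel"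
  shows "(\<lambda>n. (\<Sum>v\<in>#V n. \<psi> v) / real n) \<longlonglongrightarrow> (\<integral>x. \<psi> (u x) \<partial>M)"
proof (rule LIMSEQ_I)
  interpret prob_space M by fact
  fix e :: real assume "e > 0"
  then have e3: "e / 3 > 0" by simp
  obtain g where g: "real_polynomial_function g" "\<And>x. x \<in> {0..1} \<Longrightarrow> \<bar>\<psi> x - g x\<bar> < e / 3"
    using Stone_Weierstrass_real_polynomial_function[OF _ cont e3] by auto
  then obtain a N where gs: "g = (\<lambda>x. \<Sum>i\<le>N. a i * x ^ i)"
    unfolding real_polynomial_function_iff_sum by blast
  have [measurable]: "g \<in> borel_measurable borel" unfolding gs by measurable
  have int_pow: "integrable M (\<lambda>x. u x ^ k)" for k
    by (rule integrable_const_bound[of _ 1], rule eventually_mono[OF u01]) (auto simp: power_le_one)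
  have int_g: "integrable M (\<lambda>x. g (u x))"
    unfolding gs by (intro Bochner_Integration.integrable_sum integrable_mult_right int_pow)
  have "compact (\<psi> ` {0..1})" by (rule compact_continuous_image[OF cont]) simp
  then obtain B where "\<forall>y\<in>\<psi> ` {0..1}. norm y \<le> B"
    using compact_imp_bounded bounded_iff by blast
  then have B: "\<bar>\<psi> x\<bar> \<le> B" if "x \<in> {0..1}" for x
    using that by auto
  have int_\<psi>: "integrable M (\<lambda>x. \<psi> (u x))"
    by (rule integrable_const_bound[of _ B], rule eventually_mono[OF u01]) (auto intro: B)
  have limit_close: "\<bar>(\<integral>x. \<psi> (u x) \<partial>M) - (\<integral>x. g (u x) \<partial>M)\<bar> \<le> e / 3"
  proof -
    have "\<bar>\<integral>x. \<psi> (u x) - g (u x) \<partial>M\<bar> \<le> (\<integral>x. \<bar>\<psi> (u x) - g (u x)\<bar> \<partial>M)"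
      by (rule integral_abs_bound)
    also have "\<dots> \<le> (\<integral>x. e / 3 \<partial>M)"
    proof (rule integral_mono_AE)
      show "AE x in M. \<bar>\<psi> (u x) - g (u x)\<bar> \<le> e / 3"
        using u01 by (rule eventually_mono) (intro less_imp_le g(2))
    qed (use int_\<psi> int_g in auto)
    finally show ?thesis using int_\<psi> int_g prob_space by simp
  qed
  have emp_close: "\<bar>(\<Sum>v\<in>#V n. \<psi> v) / real n - (\<Sum>v\<in>#V n. g v) / real n\<bar> \<le> e / 3" for n
  proof -
    have "\<bar>(\<Sum>v\<in>#W. \<psi> v) - (\<Sum>v\<in>#W. g v)\<bar> \<le> real (size W) * (e / 3)"
      if "\<And>v. v \<in># W \<Longrightarrow> v \<in> {0..1}" for W
      using that
    proof (induction W)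
      case (add w W)
      then have "\<bar>\<psi> w - g w\<bar> < e / 3" "\<bar>(\<Sum>v\<in>#W. \<psi> v) - (\<Sum>v\<in>#W. g v)\<bar> \<le> real (size W) * (e / 3)"
        using g(2)[of w] by auto
      moreover have "\<bar>(\<psi> w + (\<Sum>v\<in>#W. \<psi> v)) - (g w + (\<Sum>v\<in>#W. g v))\<bar> \<le>
          \<bar>\<psi> w - g w\<bar> + \<bar>(\<Sum>v\<in>#W. \<psi> v) - (\<Sum>v\<in>#W. g v)\<bar>"
        by (rule abs_diff_triangle_ineq)
      ultimately show ?case by (simp add: distrib_right)
    qed simp
    from this[of "V n", OF V01] have "\<bar>(\<Sum>v\<in>#V n. \<psi> v) - (\<Sum>v\<in>#V n. g v)\<bar> \<le> real n * (e / 3)"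
      by (simp add: size)
    then have "\<bar>((\<Sum>v\<in>#V n. \<psi> v) - (\<Sum>v\<in>#V n. g v)) / real n\<bar> \<le> e / 3"
      using e3 by (cases "n = 0") (simp_all add: abs_divide pos_divide_le_eq mult.commute)
    then show ?thesis by (simp only: diff_divide_distrib)
  qed
  have "(\<Sum>v\<in>#W. g v) = (\<Sum>i\<le>N. a i * power_sum W i)" for W
    by (induction W) (simp_all add: gs power_sum_def sum.distrib distrib_left)
  then have "(\<lambda>n. (\<Sum>v\<in>#V n. g v) / real n) = (\<lambda>n. \<Sum>i\<le>N. a i * (power_sum (V n) i / real n))"
    by (simp add: sum_divide_distrib)
  also have "\<dots> \<longlonglongrightarrow> (\<Sum>i\<le>N. a i * (\<integral>x. u x ^ i \<partial>M))"
    by (intro tendsto_intros moments)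
  also have "(\<Sum>i\<le>N. a i * (\<integral>x. u x ^ i \<partial>M)) = (\<integral>x. g (u x) \<partial>M)"
    unfolding gs using int_pow by (subst Bochner_Integration.integral_sum) auto
  finally have "(\<lambda>n. (\<Sum>v\<in>#V n. g v) / real n) \<longlonglongrightarrow> (\<integral>x. g (u x) \<partial>M)" .
  from LIMSEQ_D[OF this e3, unfolded real_norm_def]
  obtain n0 where n0: "\<And>n. n \<ge> n0 \<Longrightarrow> \<bar>(\<Sum>v\<in>#V n. g v) / real n - (\<integral>x. g (u x) \<partial>M)\<bar> < e / 3"
    by blast
  show "\<exists>n0. \<forall>n\<ge>n0. norm ((\<Sum>v\<in>#V n. \<psi> v) / real n - (\<integral>x. \<psi> (u x) \<partial>M)) < e"
  proof (intro exI allI impI)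
    fix n assume "n \<ge> n0"
    from n0[OF this] emp_close[of n] limit_close
    show "norm ((\<Sum>v\<in>#V n. \<psi> v) / real n - (\<integral>x. \<psi> (u x) \<partial>M)) < e"
      unfolding real_norm_def by linarith
  qed
qed

section \<open>The limit of the root-counting measures\<close>

text \<open>
  The form in which the location of the nodes is used: the root belongs to a real node \<open>v\<close>, which is
  nonzero as the reciprocal of \<open>1 - x\<close>.
\<close>
lemma narayana_node_real:
  assumes "x \<in># proots (narayana_poly n)"
  obtains v :: real where "0 < v" "v \<le> 1" "1 / (1 - x) = of_real v" "x = of_real (1 - 1 / v)"
proof -
  have x1: "x \<noteq> 1" using proots_narayana_poly_neq_1[OF assms] .
  have n: "n > 0" using assms by (cases n) (auto simp: narayana_poly_def)
  have "0 \<notin># narayana_nodes n"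
    by (auto simp: narayana_nodes_def dest: proots_narayana_poly_neq_1)
  moreover have "1 / (1 - x) \<in># narayana_nodes n" using assms by (auto simp: narayana_nodes_def)
  ultimately have "1 / (1 - x) \<in> complex_of_real ` {0..1}"
    using node_in_unit_interval node_ode_narayana_nodes[OF n] by blast
  then obtain v where v: "v \<in> {0..1}" "1 / (1 - x) = of_real v" by auto
  have "v \<noteq> 0" using v(2) x1 by auto
  moreover have "x = of_real (1 - 1 / v)"
    using v(2) x1 \<open>v \<noteq> 0\<close> by (simp add: field_simps) 
  ultimately show thesis using that v by force
qed

definition real_nodes :: "nat \<Rightarrow> real multiset" where
  "real_nodes n = image_mset (\<lambda>x. Re (1 / (1 - x))) (proots (narayana_poly n))"

lemma size_real_nodes: "size (real_nodes n) = n"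
  by (simp add: real_nodes_def size_proots_complex degree_narayana_poly)

lemma real_nodes_moments:
  "(\<lambda>n. power_sum (real_nodes n) k / real n) \<longlonglongrightarrow> arcsine_moment k"
proof -
  have "complex_of_real (power_sum (real_nodes n) k) = power_sum (narayana_nodes n) k" for n
  proof -
    have "complex_of_real (\<Sum>\<^sub># M) = \<Sum>\<^sub># (image_mset of_real M)" for M
      by (induction M) auto
    then have "complex_of_real (power_sum (real_nodes n) k) =
        (\<Sum>x\<in>#proots (narayana_poly n). of_real (Re (1 / (1 - x)) ^ k))"
      by (simp add: power_sum_def real_nodes_def image_mset.compositionality comp_def)
    also have "\<dots> = (\<Sum>x\<in>#proots (narayana_poly n). (1 / (1 - x)) ^ k)"
    proof (intro arg_cong[of _ _ sum_mset] image_mset_cong)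
      fix x assume "x \<in># proots (narayana_poly n)"
      then obtain v where "1 / (1 - x) = complex_of_real v" by (rule narayana_node_real)
      then show "complex_of_real (Re (1 / (1 - x)) ^ k) = (1 / (1 - x)) ^ k" by simp
    qed
    finally show ?thesis
      by (simp add: power_sum_def narayana_nodes_def image_mset.compositionality comp_def)
  qed
  then have "(\<lambda>n. complex_of_real (power_sum (real_nodes n) k / real n)) \<longlonglongrightarrow> of_real (arcsine_moment k)"
    using power_sum_tendsto[of narayana_nodes k] node_ode_narayana_nodes by simp
  then show ?thesis by (simp only: tendsto_of_real_iff)
qed

text \<open>
  The value \<open>0\<close> at \<open>v = 0\<close>, the image of infinity, makes the pullback continuous: for small
  nonzero \<open>v\<close>, the point \<open>1 - 1 / v\<close> is outside the bounded set where \<open>\<phi>\<close> does not vanish.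
\<close>
lemma test_function_pullback:
  fixes \<phi> :: "complex \<Rightarrow> real"
  assumes "test_function \<phi>"
  shows "continuous_on UNIV (\<lambda>v. if v = 0 then 0 else \<phi> (of_real (1 - 1 / v)))" (is "continuous_on _ ?\<psi>")
proof -
  have cont: "continuous_on UNIV \<phi>"
    using assms by (simp add: test_function_def smooth_imp_continuous)
  have "bounded {z. \<phi> z \<noteq> 0}"
    using assms compact_imp_bounded bounded_subset[OF _ closure_subset] unfolding test_function_def by metis
  then obtain K where K: "\<And>z. \<phi> z \<noteq> 0 \<Longrightarrow> norm z \<le> K"
    by (auto simp: bounded_iff)
  have "isCont ?\<psi> v" for v
  proof (cases "v = 0")
    case True
    define d where "d = 1 / (\<bar>K\<bar> + 2)"
    have d: "d > 0" by (simp add: d_def)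
    \<comment> \<open>For \<open>\<bar>w\<bar> < d\<close>, the point \<open>1 - 1 / w\<close> has modulus greater than \<open>K\<close>.\<close>
    have zero: "?\<psi> w = 0" if "\<bar>w\<bar> < d" for w
    proof (cases "w = 0")
      case False
      then have "\<bar>K\<bar> + 2 < 1 / \<bar>w\<bar>" using that d by (simp add: d_def field_simps)
      also have "1 / \<bar>w\<bar> \<le> \<bar>1 - 1 / w\<bar> + 1" by (simp add: abs_if)
      finally have "norm (complex_of_real (1 - 1 / w)) > K" by (simp only: norm_of_real)
      then show ?thesis using K by (metis not_le)
    qed simp
    have "eventually (\<lambda>w. ?\<psi> w = 0) (nhds 0)"
    proof (rule eventually_mono)
      show "eventually (\<lambda>w. w \<in> ball 0 d) (nhds 0)"
        using d by (intro eventually_nhds_in_open) auto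
    qed (rule zero, simp add: dist_real_def)
    then have "isCont ?\<psi> 0 \<longleftrightarrow> isCont (\<lambda>_. 0 :: real) (0::real)"
      by (rule isCont_cong)
    then show ?thesis using True by simp
  next
    case False
    have "isCont \<phi> z" for z using cont by (simp add: continuous_on_eq_continuous_at)
    moreover have "isCont (\<lambda>w. complex_of_real (1 - 1 / w)) v"
      using False by (intro continuous_intros)
    ultimately have c: "isCont (\<lambda>w. \<phi> (complex_of_real (1 - 1 / w))) v"
      by (rule isCont_o2[rotated])
    have "eventually (\<lambda>w. w \<in> - {0}) (nhds v)"
      using False by (intro eventually_nhds_in_open) auto
    then have "eventually (\<lambda>w. ?\<psi> w = \<phi> (complex_of_real (1 - 1 / w))) (nhds v)"
      by (rule eventually_mono) simp
    from isCont_cong[OF this] c show ?thesis by blast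
  qed
  then show ?thesis by (simp add: continuous_on_eq_continuous_at)
qed

abbreviation "complex_limit_measure \<equiv> distr limit_measure borel complex_of_real"

lemma narayana_limit:
  "asymptotic_root_counting_measure narayana_poly complex_limit_measure"
  unfolding asymptotic_root_counting_measure_def
proof
  interpret prob_space limit_measure by (rule prob_space_limit_measure)
  interpret D: prob_space complex_limit_measure by (rule prob_space_distr) simp
  show "radon_measure complex_limit_measure"
    unfolding radon_measure_def by (auto simp: less_top[symmetric])
  show "distributional_limit (\<lambda>n. root_counting_measure (narayana_poly n)) complex_limit_measure"
    unfolding distributional_limit_def
  proof (intro allI impI)
    fix \<phi> :: "complex \<Rightarrow> real" assume tf: "test_function \<phi>"
    have meas[measurable]: "\<phi> \<in> borel_measurable borel"
      using tf by (auto simp: test_function_def intro: borel_measurable_continuous_onI smooth_imp_continuous)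
    define \<psi> where "\<psi> v = (if v = 0 then 0 else \<phi> (of_real (1 - 1 / v)))" for v :: real
    have cont: "continuous_on UNIV \<psi>" unfolding \<psi>_def[abs_def] by (rule test_function_pullback) fact
    have "(\<lambda>n. (\<Sum>v\<in>#real_nodes n. \<psi> v) / real n) \<longlonglongrightarrow> (\<integral>x. \<psi> (1 / (1 - x)) \<partial>limit_measure)"
    proof (rule method_of_moments)
      show "AE x in limit_measure. 1 / (1 - x) \<in> {0..1}"
        using AE_limit_measure by (auto elim!: eventually_mono)
      show "v \<in> {0..1}" if "v \<in># real_nodes n" for n v
        using that by (auto simp: real_nodes_def elim!: narayana_node_real)
      show "(\<lambda>n. power_sum (real_nodes n) k / real n) \<longlonglongrightarrow> (\<integral>x. (1 / (1 - x)) ^ k \<partial>limit_measure)" for k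
        unfolding limit_moments by (rule real_nodes_moments)
    qed (use prob_space_limit_measure size_real_nodes cont in
          \<open>auto intro: continuous_on_subset borel_measurable_continuous_onI\<close>)
    also have "(\<integral>x. \<psi> (1 / (1 - x)) \<partial>limit_measure) = (\<integral>z. \<phi> z \<partial>complex_limit_measure)"
    proof -
      have [measurable]: "\<psi> \<in> borel_measurable borel" using cont by (rule borel_measurable_continuous_onI)
      have "(\<integral>x. \<psi> (1 / (1 - x)) \<partial>limit_measure) = (\<integral>x. \<phi> (complex_of_real x) \<partial>limit_measure)"
      proof (rule integral_cong_AE)
        show "AE x in limit_measure. \<psi> (1 / (1 - x)) = \<phi> (complex_of_real x)"
          using AE_limit_measure by (rule eventually_mono) (simp add: \<psi>_def)
      qed auto
      then show ?thesis by (simp add: integral_distr)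
    qed
    finally have lim: "(\<lambda>n. (\<Sum>v\<in>#real_nodes n. \<psi> v) / real n) \<longlonglongrightarrow> (\<integral>z. \<phi> z \<partial>complex_limit_measure)" .
    have "eventually (\<lambda>n. (\<Sum>v\<in>#real_nodes n. \<psi> v) / real n = (\<integral>z. \<phi> z \<partial>root_counting_measure (narayana_poly n))) sequentially"
      using eventually_gt_at_top[of 0]
    proof eventually_elim
      case (elim n)
      have "(\<Sum>v\<in>#real_nodes n. \<psi> v) = (\<Sum>x\<in>#proots (narayana_poly n). \<phi> x)"
        unfolding real_nodes_def image_mset.compositionality comp_def
      proof (intro arg_cong[of _ _ sum_mset] image_mset_cong)
        fix x assume "x \<in># proots (narayana_poly n)"
        then obtain v where "0 < v" "1 / (1 - x) = complex_of_real v" "x = of_real (1 - 1 / v)"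
          by (rule narayana_node_real)
        then show "\<psi> (Re (1 / (1 - x))) = \<phi> x" by (simp add: \<psi>_def)
      qed
      then show ?case
        using elim by (simp add: integral_root_counting_measure degree_narayana_poly)
    qed
    then show "(\<lambda>n. \<integral>z. \<phi> z \<partial>root_counting_measure (narayana_poly n)) \<longlonglongrightarrow> (\<integral>z. \<phi> z \<partial>complex_limit_measure)"
      by (rule Lim_transform_eventually[OF lim])
  qed
qed

text \<open>
  Integrals of test functions against the limit are limits of sequences of real numbers, hence unique.
\<close>
lemma asymptotic_root_counting_measure_unique:
  assumes "asymptotic_root_counting_measure P \<mu>" "asymptotic_root_counting_measure P \<nu>"
  shows "\<mu> = \<nu>"
proof (rule radon_measure_eqI)
  show "(\<integral>z. \<phi> z \<partial>\<mu>) = (\<integral>z. \<phi> z \<partial>\<nu>)" if "test_function \<phi>" for \<phi>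
    using assms that unfolding asymptotic_root_counting_measure_def distributional_limit_def
    by (blast intro: LIMSEQ_unique)
qed (use assms in \<open>auto simp: asymptotic_root_counting_measure_def\<close>)

lemma emeasure_complex_limit_measure_image:
  "emeasure complex_limit_measure (complex_of_real ` {..x}) = emeasure limit_measure {..x}"
proof -
  have "closed (complex_of_real ` {..x})"
  proof -
    have "complex_of_real ` {..x} = {z. Im z = 0 \<and> Re z \<le> x}"
      by (auto simp: complex_eq_iff image_iff intro: exI[of _ "Re _"])
    then show ?thesis by (simp add: closed_Collect_conj closed_Collect_eq closed_Collect_le continuous_intros)
  qed
  moreover have "complex_of_real -` (complex_of_real ` {..x}) = {..x}" by auto
  ultimately show ?thesis by (simp add: emeasure_distr)
qed

theorem theorem8:
  shows "(\<exists>\<mu>. asymptotic_root_counting_measure narayana_poly \<mu>) \<and>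
    (\<forall>\<mu>. asymptotic_root_counting_measure narayana_poly \<mu> \<longrightarrow>
       emeasure \<mu> (- (complex_of_real ` {..0})) = 0 \<and>
       \<mu> = distr
             (density lborel
               (\<lambda>x::real. if x < 0 then ennreal (1 / pi * (1 / ((1 - x) * sqrt (- x)))) else 0))
             borel complex_of_real \<and>
       (\<forall>x\<le>0. emeasure \<mu> (complex_of_real ` {..x}) =
                ennreal (1 - 2 / pi * arctan (sqrt (- x)))))"
proof (intro conjI allI impI)
  show "\<exists>\<mu>. asymptotic_root_counting_measure narayana_poly \<mu>"
    using narayana_limit by blast
next
  fix \<mu> assume "asymptotic_root_counting_measure narayana_poly \<mu>"
  then have \<mu>: "\<mu> = complex_limit_measure"
    using narayana_limit asymptotic_root_counting_measure_unique by blast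
  have "(\<lambda>x. ennreal (limit_density x)) =
      (\<lambda>x. if x < 0 then ennreal (1 / pi * (1 / ((1 - x) * sqrt (- x)))) else 0)"
    by (auto simp: limit_density_def)
  then show "\<mu> = distr (density lborel
      (\<lambda>x::real. if x < 0 then ennreal (1 / pi * (1 / ((1 - x) * sqrt (- x)))) else 0)) borel complex_of_real"
    unfolding \<mu> limit_measure_def by (simp only:)
  show cdf: "emeasure \<mu> (complex_of_real ` {..x}) = ennreal (1 - 2 / pi * arctan (sqrt (- x)))"
    if "x \<le> 0" for x
    using that by (simp add: \<mu> emeasure_complex_limit_measure_image emeasure_limit_measure_atMost limit_cdf_def)
  show "emeasure \<mu> (- (complex_of_real ` {..0})) = 0"
  proof -
    interpret prob_space limit_measure by (rule prob_space_limit_measure)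
    interpret D: prob_space \<mu> unfolding \<mu> by (rule prob_space_distr) simp
    have "complex_of_real ` {..0} \<in> sets \<mu>"
    proof (rule ccontr)
      assume "complex_of_real ` {..0} \<notin> sets \<mu>"
      then show False using cdf[of 0] by (simp add: emeasure_notin_sets)
    qed
    moreover have "space \<mu> = UNIV" by (simp add: \<mu>)
    ultimately show ?thesis
      using emeasure_compl[of "complex_of_real ` {..0}" \<mu>] cdf[of 0] D.emeasure_space_1
      by (simp add: Compl_eq_Diff_UNIV)
  qed
qed

end
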